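(* Let $(A_i,H_i,D_i,\gamma_i,J_i)$, $i=1,2$, be two unital even spectral triples with (possibly twisted) real structures $J_i$ (with $A_1,A_2$ complex algebras), both satisfying the second-order condition $\mathcal{C}\ell_{D_i}(A_i)^\circ\subset\mathcal{C}\ell_{D_i}(A_i)'$. Let $$A=A_1\otimes A_2,\quad H=H_1\otimes H_2,\quad D=D_1\otimes 1+\gamma_1\otimes D_2,\quad \gamma=\gamma_1\otimes\gamma_2$$ be their product, and equip it with the antilinear map $J$ on $H$ determined by $$J(v\otimes w)=(-1)^{|v|\,|w|}J_1(v)\otimes J_2(w)$$ for all homogeneous $v\in H_1$, $w\in H_2$. Then $(A,H,D,\gamma)$ with $J$ satisfies the second-order condition as well: $\mathcal{C}\ell_D(A)^\circ\subset\mathcal{C}\ell_D(A)'$.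
   Context: A unital spectral triple $(A,H,D)$: $H$ a complex Hilbert space, $A\subset\mathcal{B}(H)$ a unital $*$-subalgebra, $D$ self-adjoint with compact resolvent, $a\,\mathrm{Dom}(D)\subset\mathrm{Dom}(D)$ and $[D,a]$ extends to a bounded operator for all $a\in A$. It is even if equipped with a bounded self-adjoint $\gamma$, $\gamma^2=1$, commuting with $A$ and anticommuting with $D$. $\Omega^1_D(A)$ is the complex span of $\{a[D,b]:a,b\in A\}$; $\mathcal{C}\ell_D(A)$ is the complex $C^*$-subalgebra of $\mathcal{B}(H)$ generated by $A$ and $\Omega^1_D(A)$. $S'$ is the commutant in $\mathcal{B}(H)$; given an antilinear isometry $J$ on $H$, $\xi^\circ=J\xi^*J^{-1}$ and $S^\circ=\{\xi^\circ:\xi\in S\}$ (for the $i$-th triple, $^\circ$ is defined with $J_i$; for the product, with $J$). A real structure on an even spectral triple is an antilinear isometry $J$ with $A^\circ\subset A'$, $\Omega^1_D(A)^\circ\subset A'$, $J^2=\varepsilon 1$, $JD=\varepsilon' DJ$ (with $J$ preserving $\mathrm{Dom}(D)$), $J\gamma=\varepsilon''\gamma J$ for some signs $\varepsilon,\varepsilon',\varepsilon''\in\{\pm1\}$. A $\tau$-twisted real structure ($\tau\in\mathcal{B}(H)$) is defined in the same way but with the condition on $D$ replaced by: $J\tau$ preserves $\mathrm{Dom}(D)$ and $\tau JD=\varepsilon'DJ\tau$. A vector $v\in H_i$ is homogeneous of degree $|v|\in\{0,1\}$ if $\gamma_iv=(-1)^{|v|}v$. All tensor products are over $\mathbb{C}$: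 algebraic for $A$, Hilbert space tensor product for $H$; $D$ denotes the self-adjoint closure. *)

theory Defs
  imports "HOL-Analysis.Analysis"
begin

section \<open>Complex Hilbert spaces and bounded operators\<close>

text \<open>The inner product is linear in the second argument. Completeness comes from the superclass.\<close>

class complex_hilbert = banach +
  fixes scaleC :: "complex \<Rightarrow> 'a \<Rightarrow> 'a" (infixr "*\<^sub>C" 75)
    and cinner :: "'a \<Rightarrow> 'a \<Rightarrow> complex"
  assumes scaleC_add_right: "c *\<^sub>C (x + y) = c *\<^sub>C x + c *\<^sub>C y"
    and scaleC_add_left: "(c + d) *\<^sub>C x = c *\<^sub>C x + d *\<^sub>C x"
    and scaleC_scaleC: "c *\<^sub>C (d *\<^sub>C x) = (c * d) *\<^sub>C x"
    and scaleR_scaleC: "r *\<^sub>R x = complex_of_real r *\<^sub>C x"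
    and cinner_commute: "cinner x y = cnj (cinner y x)"
    and cinner_add_right: "cinner x (y + z) = cinner x y + cinner x z"
    and cinner_scaleC_right: "cinner x (c *\<^sub>C y) = c * cinner x y"
    and cinner_norm: "cinner x x = complex_of_real ((norm x)\<^sup>2)"

definition bounded_clinear :: "('a::complex_hilbert \<Rightarrow> 'b::complex_hilbert) \<Rightarrow> bool" where
  "bounded_clinear T \<longleftrightarrow> bounded_linear T \<and> (\<forall>c x. T (c *\<^sub>C x) = c *\<^sub>C T x)"

definition antilinear_isometry :: "('a::complex_hilbert \<Rightarrow> 'a) \<Rightarrow> bool" where
  "antilinear_isometry J \<longleftrightarrow>
     (\<forall>x y. J (x + y) = J x + J y) \<and> (\<forall>c x. J (c *\<^sub>C x) = cnj c *\<^sub>C J x) \<and>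
     (\<forall>x. norm (J x) = norm x)"

definition cadjoint :: "('a::complex_hilbert \<Rightarrow> 'a) \<Rightarrow> ('a \<Rightarrow> 'a)" where
  "cadjoint T = (THE S. bounded_clinear S \<and> (\<forall>x y. cinner (T x) y = cinner x (S y)))"

definition op_span :: "('a::complex_hilbert \<Rightarrow> 'a) set \<Rightarrow> ('a \<Rightarrow> 'a) set" where
  "op_span S = {(\<lambda>x. \<Sum>i<n. c i *\<^sub>C T i x) | (n::nat) c T. \<forall>i<n. T i \<in> S}"

definition star_subalgebra :: "('a::complex_hilbert \<Rightarrow> 'a) set \<Rightarrow> bool" where
  "star_subalgebra B \<longleftrightarrow>
     (\<forall>S\<in>B. bounded_clinear S) \<and> (\<lambda>x. 0) \<in> B \<and>
     (\<forall>S\<in>B. \<forall>T\<in>B. (\<lambda>x. S x + T x) \<in> B) \<and>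
     (\<forall>c. \<forall>S\<in>B. (\<lambda>x. c *\<^sub>C S x) \<in> B) \<and>
     (\<forall>S\<in>B. \<forall>T\<in>B. S \<circ> T \<in> B) \<and>
     (\<forall>S\<in>B. cadjoint S \<in> B)"

definition cstar_subalgebra :: "('a::complex_hilbert \<Rightarrow> 'a) set \<Rightarrow> bool" where
  "cstar_subalgebra B \<longleftrightarrow> star_subalgebra B \<and>
     (\<forall>F T. (\<forall>n::nat. F n \<in> B) \<longrightarrow> bounded_clinear T \<longrightarrow>
        (\<lambda>n. onorm (\<lambda>x. F n x - T x)) \<longlonglongrightarrow> 0 \<longrightarrow> T \<in> B)"

definition cstar_generated :: "('a::complex_hilbert \<Rightarrow> 'a) set \<Rightarrow> ('a \<Rightarrow> 'a) set" where
  "cstar_generated S = \<Inter>{B. cstar_subalgebra B \<and> S \<subseteq> B}"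

definition commutant :: "('a::complex_hilbert \<Rightarrow> 'a) set \<Rightarrow> ('a \<Rightarrow> 'a) set" where
  "commutant S = {T. bounded_clinear T \<and> (\<forall>R\<in>S. T \<circ> R = R \<circ> T)}"

definition opposite :: "('a::complex_hilbert \<Rightarrow> 'a) \<Rightarrow> ('a \<Rightarrow> 'a) \<Rightarrow> ('a \<Rightarrow> 'a)" where
  "opposite J T = J \<circ> cadjoint T \<circ> inv J"


section \<open>Unbounded operators\<close>

text \<open>An unbounded operator is represented by its graph: its domain is \<open>Domain D\<close>, and its
  closure is the topological closure of the graph in the product space.\<close>

definition opval :: "('a \<times> 'a) set \<Rightarrow> 'a \<Rightarrow> 'a" where
  "opval D x = (THE y. (x, y) \<in> D)"

definition linear_operator :: "('a::complex_hilbert \<times> 'a) set \<Rightarrow> bool" where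
  "linear_operator D \<longleftrightarrow> single_valued D \<and> (0, 0) \<in> D \<and>
     (\<forall>x y u v. (x, y) \<in> D \<longrightarrow> (u, v) \<in> D \<longrightarrow> (x + u, y + v) \<in> D) \<and>
     (\<forall>c x y. (x, y) \<in> D \<longrightarrow> (c *\<^sub>C x, c *\<^sub>C y) \<in> D)"

definition adjoint_graph :: "('a::complex_hilbert \<times> 'a) set \<Rightarrow> ('a \<times> 'a) set" where
  "adjoint_graph D = {(x, y). \<forall>(u, v)\<in>D. cinner v x = cinner u y}"

definition self_adjoint :: "('a::complex_hilbert \<times> 'a) set \<Rightarrow> bool" where
  "self_adjoint D \<longleftrightarrow> linear_operator D \<and> closure (Domain D) = UNIV \<and> adjoint_graph D = D"

text \<open>\<open>R\<close> is the bounded inverse of \<open>D - z\<close>.\<close>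

definition is_resolvent :: "('a::complex_hilbert \<times> 'a) set \<Rightarrow> complex \<Rightarrow> ('a \<Rightarrow> 'a) \<Rightarrow> bool" where
  "is_resolvent D z R \<longleftrightarrow> bounded_clinear R \<and>
     (\<forall>x. R x \<in> Domain D \<and> opval D (R x) - z *\<^sub>C R x = x) \<and>
     (\<forall>x\<in>Domain D. R (opval D x - z *\<^sub>C x) = x)"

definition compact_operator :: "('a::complex_hilbert \<Rightarrow> 'a) \<Rightarrow> bool" where
  "compact_operator R \<longleftrightarrow> bounded_clinear R \<and> compact (closure (R ` cball 0 1))"

text \<open>By the resolvent identity it does not matter at which point the resolvent is taken.\<close>

definition compact_resolvent :: "('a::complex_hilbert \<times> 'a) set \<Rightarrow> bool" where
  "compact_resolvent D \<longleftrightarrow> (\<exists>z R. is_resolvent D z R \<and> compact_operator R)"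

definition extends_commutator ::
  "('a::complex_hilbert \<times> 'a) set \<Rightarrow> ('a \<Rightarrow> 'a) \<Rightarrow> ('a \<Rightarrow> 'a) \<Rightarrow> bool" where
  "extends_commutator D a T \<longleftrightarrow> bounded_clinear T \<and>
     (\<forall>x\<in>Domain D. a x \<in> Domain D \<and> T x = opval D (a x) - a (opval D x))"

definition bcommutator :: "('a::complex_hilbert \<times> 'a) set \<Rightarrow> ('a \<Rightarrow> 'a) \<Rightarrow> ('a \<Rightarrow> 'a)" where
  "bcommutator D a = (THE T. extends_commutator D a T)"


section \<open>Even spectral triples\<close>

record 'h even_triple =
  alg :: "('h \<Rightarrow> 'h) set"
  dirac :: "('h \<times> 'h) set"
  grading :: "'h \<Rightarrow> 'h"

definition spectral_triple ::
  "('h::complex_hilbert \<Rightarrow> 'h) set \<Rightarrow> ('h \<times> 'h) set \<Rightarrow> bool" where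
  "spectral_triple A D \<longleftrightarrow>
     star_subalgebra A \<and> id \<in> A \<and> self_adjoint D \<and> compact_resolvent D \<and>
     (\<forall>a\<in>A. a ` Domain D \<subseteq> Domain D \<and> (\<exists>T. extends_commutator D a T))"

definition even_spectral_triple :: "('h::complex_hilbert) even_triple \<Rightarrow> bool" where
  "even_spectral_triple X \<longleftrightarrow> spectral_triple (alg X) (dirac X) \<and>
     bounded_clinear (grading X) \<and> cadjoint (grading X) = grading X \<and>
     grading X \<circ> grading X = id \<and>
     (\<forall>a\<in>alg X. grading X \<circ> a = a \<circ> grading X) \<and>
     (\<forall>x\<in>Domain (dirac X). grading X x \<in> Domain (dirac X) \<and>
        opval (dirac X) (grading X x) = - grading X (opval (dirac X) x))"

definition one_forms :: "('h::complex_hilbert) even_triple \<Rightarrow> ('h \<Rightarrow> 'h) set" where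
  "one_forms X = op_span {a \<circ> bcommutator (dirac X) b | a b. a \<in> alg X \<and> b \<in> alg X}"

definition clifford :: "('h::complex_hilbert) even_triple \<Rightarrow> ('h \<Rightarrow> 'h) set" where
  "clifford X = cstar_generated (alg X \<union> one_forms X)"


section \<open>Real structures\<close>

definition reality_conditions :: "('h::complex_hilbert) even_triple \<Rightarrow> ('h \<Rightarrow> 'h) \<Rightarrow> bool" where
  "reality_conditions X J \<longleftrightarrow> antilinear_isometry J \<and>
     opposite J ` alg X \<subseteq> commutant (alg X) \<and>
     opposite J ` one_forms X \<subseteq> commutant (alg X) \<and>
     (\<exists>e\<in>{1, -1::real}. \<forall>x. J (J x) = e *\<^sub>R x) \<and>
     (\<exists>e\<in>{1, -1::real}. \<forall>x. J (grading X x) = e *\<^sub>R grading X (J x))"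

definition real_structure :: "('h::complex_hilbert) even_triple \<Rightarrow> ('h \<Rightarrow> 'h) \<Rightarrow> bool" where
  "real_structure X J \<longleftrightarrow> reality_conditions X J \<and>
     (\<exists>e\<in>{1, -1::real}. \<forall>x\<in>Domain (dirac X). J x \<in> Domain (dirac X) \<and>
        J (opval (dirac X) x) = e *\<^sub>R opval (dirac X) (J x))"

definition twisted_real_structure ::
  "('h::complex_hilbert \<Rightarrow> 'h) \<Rightarrow> 'h even_triple \<Rightarrow> ('h \<Rightarrow> 'h) \<Rightarrow> bool" where
  "twisted_real_structure \<tau> X J \<longleftrightarrow> bounded_clinear \<tau> \<and> reality_conditions X J \<and>
     (\<exists>e\<in>{1, -1::real}. \<forall>x\<in>Domain (dirac X). J (\<tau> x) \<in> Domain (dirac X) \<and>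
        \<tau> (J (opval (dirac X) x)) = e *\<^sub>R opval (dirac X) (J (\<tau> x)))"

definition second_order_condition ::
  "('h::complex_hilbert) even_triple \<Rightarrow> ('h \<Rightarrow> 'h) \<Rightarrow> bool" where
  "second_order_condition X J \<longleftrightarrow> opposite J ` clifford X \<subseteq> commutant (clifford X)"


section \<open>Products\<close>

text \<open>The predicate below says that the Hilbert space \<open>'c\<close>, with \<open>t v w\<close> in the role of
  the simple tensor of \<open>v\<close> and \<open>w\<close>, is the Hilbert space tensor product of \<open>'a\<close> and
  \<open>'b\<close>: the linear span of the simple tensors is (isometrically) the algebraic tensor product with
  its usual inner product, and \<open>'c\<close> is the completion of it. This determines \<open>'c\<close> and \<open>t\<close>
  up to a unique unitary.\<close>

definition hilbert_tensor ::
  "('a::complex_hilbert \<Rightarrow> 'b::complex_hilbert \<Rightarrow> 'c::complex_hilbert) \<Rightarrow> bool" where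
  "hilbert_tensor t \<longleftrightarrow>
     (\<forall>v v' w. t (v + v') w = t v w + t v' w) \<and>
     (\<forall>v w w'. t v (w + w') = t v w + t v w') \<and>
     (\<forall>c v w. t (c *\<^sub>C v) w = c *\<^sub>C t v w) \<and>
     (\<forall>c v w. t v (c *\<^sub>C w) = c *\<^sub>C t v w) \<and>
     (\<forall>v w v' w'. cinner (t v w) (t v' w') = cinner v v' * cinner w w') \<and>
     closure {\<Sum>i<n. t (v i) (w i) | (n::nat) v w. True} = UNIV"

definition op_tensor ::
  "('a::complex_hilbert \<Rightarrow> 'b::complex_hilbert \<Rightarrow> 'c::complex_hilbert) \<Rightarrow>
   ('a \<Rightarrow> 'a) \<Rightarrow> ('b \<Rightarrow> 'b) \<Rightarrow> ('c \<Rightarrow> 'c)" where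
  "op_tensor t S R = (THE T. bounded_clinear T \<and> (\<forall>v w. T (t v w) = t (S v) (R w)))"

definition product_alg ::
  "('a::complex_hilbert \<Rightarrow> 'b::complex_hilbert \<Rightarrow> 'c::complex_hilbert) \<Rightarrow>
   ('a \<Rightarrow> 'a) set \<Rightarrow> ('b \<Rightarrow> 'b) set \<Rightarrow> ('c \<Rightarrow> 'c) set" where
  "product_alg t A1 A2 = op_span {op_tensor t a b | a b. a \<in> A1 \<and> b \<in> A2}"

text \<open>The closure of \<open>D1 \<otimes> 1 + \<gamma>1 \<otimes> D2\<close> on the algebraic tensor product of the domains.\<close>

definition product_dirac ::
  "('a::complex_hilbert \<Rightarrow> 'b::complex_hilbert \<Rightarrow> 'c::complex_hilbert) \<Rightarrow>
   ('a \<times> 'a) set \<Rightarrow> ('a \<Rightarrow> 'a) \<Rightarrow> ('b \<times> 'b) set \<Rightarrow> ('c \<times> 'c) set" where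
  "product_dirac t D1 \<gamma>1 D2 = closure
     {(\<Sum>i<n. t (v i) (w i), \<Sum>i<n. t (opval D1 (v i)) (w i) + t (\<gamma>1 (v i)) (opval D2 (w i)))
      | (n::nat) v w. \<forall>i<n. v i \<in> Domain D1 \<and> w i \<in> Domain D2}"

definition product_triple ::
  "('a::complex_hilbert \<Rightarrow> 'b::complex_hilbert \<Rightarrow> 'c::complex_hilbert) \<Rightarrow>
   'a even_triple \<Rightarrow> 'b even_triple \<Rightarrow> 'c even_triple" where
  "product_triple t X1 X2 =
     \<lparr>alg = product_alg t (alg X1) (alg X2),
      dirac = product_dirac t (dirac X1) (grading X1) (dirac X2),
      grading = op_tensor t (grading X1) (grading X2)\<rparr>"

definition homogeneous :: "('h::complex_hilbert) even_triple \<Rightarrow> nat \<Rightarrow> 'h \<Rightarrow> bool" where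
  "homogeneous X p v \<longleftrightarrow> p \<in> {0, 1} \<and> grading X v = (-1) ^ p *\<^sub>R v"

definition product_J ::
  "('a::complex_hilbert \<Rightarrow> 'b::complex_hilbert \<Rightarrow> 'c::complex_hilbert) \<Rightarrow>
   'a even_triple \<Rightarrow> 'b even_triple \<Rightarrow> ('a \<Rightarrow> 'a) \<Rightarrow> ('b \<Rightarrow> 'b) \<Rightarrow> ('c \<Rightarrow> 'c)" where
  "product_J t X1 X2 J1 J2 = (THE J. antilinear_isometry J \<and>
     (\<forall>p q v w. homogeneous X1 p v \<longrightarrow> homogeneous X2 q w \<longrightarrow>
        J (t v w) = (-1) ^ (p * q) *\<^sub>R t (J1 v) (J2 w)))"

end

theory Submission
  imports Defs
begin

text \<open>Let \<open>C1\<close>, \<open>C2\<close> be the Clifford algebras of the factors. Since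
  \<open>[D, a \<otimes> b] = [D1, a] \<otimes> b + \<gamma>1 a \<otimes> [D2, b]\<close>, the Clifford algebra of the product is contained in
  the \<open>C\<^sup>*\<close>-algebra generated by the operators \<open>\<gamma>1\<^sup>q x \<otimes> y\<close> with \<open>x \<in> C1\<close> and \<open>y \<in> C2\<close> homogeneous
  of degrees \<open>p\<close> and \<open>q\<close>. The sign in \<open>J\<close> gives
  \<open>J (\<gamma>1\<^sup>q x \<otimes> y) J\<^sup>-\<^sup>1 = \<plusminus> x' \<otimes> y' \<gamma>2\<^sup>p\<close> with \<open>x' = J1 x J1\<^sup>-\<^sup>1\<close> and \<open>y' = J2 y J2\<^sup>-\<^sup>1\<close>. Moving this past
  another \<open>\<gamma>1\<^sup>s a \<otimes> b\<close> produces the sign \<open>(-1)^(p s)\<close> twice, once in each leg, so the two commute by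
  the second-order conditions of the factors. As the commutant of a set closed under adjoints is a
  \<open>C\<^sup>*\<close>-algebra, commutation passes from the generators to the algebras they generate.\<close>

section \<open>Complex Hilbert spaces\<close>

text \<open>\<open>op_tensor\<close>, \<open>product_J\<close> and \<open>bcommutator\<close> are
  definite descriptions, so they can be used only after existence and uniqueness are proved. Bounded
  operators on the completed tensor product come from orthogonalising one leg; \<open>J\<close> is
  \<open>J1\<close> tensor \<open>J2\<close> after a unitary that inserts the Koszul sign; a
  commutator with the closed operator \<open>D\<close> is recognised by a property of graphs that
  survives closure. The Clifford algebra of a factor need not contain its grading, so the powers of
  \<gamma>1 stay visible in the generators. Tying the exponent of \<gamma>1 to the degree
  \<open>q\<close> of \<open>y\<close> is what controls the signs: under \<open>J\<close>, the sign
  produced by \<open>\<gamma>1^q\<close> cancels exactly the part of the Koszul sign that depends on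
  \<open>q\<close>. The commutation relation involves two elements, one of them under an antilinear
  conjugation, so the passage from generators to the generated algebra is made in one argument at a
  time.\<close>

lemma scaleC_zero_right [simp]: "c *\<^sub>C (0::'a::complex_hilbert) = 0"
  using scaleC_add_right[of c 0 "0::'a"] by simp

lemma scaleC_zero_left [simp]: "0 *\<^sub>C (x::'a::complex_hilbert) = 0"
  using scaleR_scaleC[of 0 x] by simp

lemma scaleC_one [simp]: "1 *\<^sub>C (x::'a::complex_hilbert) = x"
  using scaleR_scaleC[of 1 x] by simp

lemma scaleC_minus_left [simp]: "(- c) *\<^sub>C (x::'a::complex_hilbert) = - (c *\<^sub>C x)"
  using scaleC_add_left[of c "- c" x] by (simp add: minus_unique)

lemma scaleC_minus_right [simp]: "c *\<^sub>C (- x::'a::complex_hilbert) = - (c *\<^sub>C x)"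
  using scaleC_add_right[of c x "- x"] by (simp add: minus_unique)

lemma scaleC_diff_right: "c *\<^sub>C (x - y::'a::complex_hilbert) = c *\<^sub>C x - c *\<^sub>C y"
  using scaleC_add_right[of c x "- y"] by simp

lemma cinner_add_left: "cinner (x + y) (z::'a::complex_hilbert) = cinner x z + cinner y z"
  by (metis cinner_commute cinner_add_right complex_cnj_add)

lemma cinner_scaleC_left: "cinner (c *\<^sub>C x) (y::'a::complex_hilbert) = cnj c * cinner x y"
  by (metis cinner_commute cinner_scaleC_right complex_cnj_mult)

lemma cinner_zero_right [simp]: "cinner x (0::'a::complex_hilbert) = 0"
  using cinner_add_right[of x 0 0] by simp

lemma cinner_zero_left [simp]: "cinner 0 (x::'a::complex_hilbert) = 0"
  using cinner_add_left[of 0 0 x] by simp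

lemma cinner_minus_right [simp]: "cinner x (- y::'a::complex_hilbert) = - cinner x y"
  using cinner_add_right[of x y "- y"] by (simp add: minus_unique)

lemma cinner_minus_left [simp]: "cinner (- x) (y::'a::complex_hilbert) = - cinner x y"
  using cinner_add_left[of x "- x" y] by (simp add: minus_unique)

lemma cinner_diff_right: "cinner x (y - z::'a::complex_hilbert) = cinner x y - cinner x z"
  using cinner_add_right[of x y "- z"] by simp

lemma cinner_diff_left: "cinner (x - y) (z::'a::complex_hilbert) = cinner x z - cinner y z"
  using cinner_add_left[of x "- y" z] by simp

lemma cinner_scaleR_right: "cinner x (r *\<^sub>R y::'a::complex_hilbert) = r *\<^sub>R cinner x y"
  by (simp add: scaleR_scaleC cinner_scaleC_right scaleR_conv_of_real)

lemma cinner_scaleR_left: "cinner (r *\<^sub>R x) (y::'a::complex_hilbert) = r *\<^sub>R cinner x y"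
  by (simp add: scaleR_scaleC cinner_scaleC_left scaleR_conv_of_real)

lemma cinner_sum_right:
  "cinner x (\<Sum>i\<in>I. f i :: 'a::complex_hilbert) = (\<Sum>i\<in>I. cinner x (f i))"
  by (induction I rule: infinite_finite_induct) (auto simp: cinner_add_right)

lemma cinner_sum_left:
  "cinner (\<Sum>i\<in>I. f i :: 'a::complex_hilbert) x = (\<Sum>i\<in>I. cinner (f i) x)"
  by (induction I rule: infinite_finite_induct) (auto simp: cinner_add_left)

lemma cinner_eq_zero_commute: "cinner x (y::'a::complex_hilbert) = 0 \<longleftrightarrow> cinner y x = 0"
  by (metis cinner_commute complex_cnj_zero)

lemma cinner_self_eq_zero [simp]: "cinner x (x::'a::complex_hilbert) = 0 \<longleftrightarrow> x = 0"
  by (simp add: cinner_norm)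

lemma power2_norm_eq_cinner: "(norm (x::'a::complex_hilbert))\<^sup>2 = Re (cinner x x)"
  by (simp add: cinner_norm)

lemma norm_scaleC: "norm (c *\<^sub>C x::'a::complex_hilbert) = cmod c * norm x"
proof -
  have "complex_of_real ((norm (c *\<^sub>C x))\<^sup>2) = of_real ((cmod c * norm x)\<^sup>2)"
    unfolding cinner_norm[symmetric] cinner_scaleC_left cinner_scaleC_right
    by (simp add: cinner_norm power_mult_distrib complex_norm_square[symmetric])
  then have "(norm (c *\<^sub>C x))\<^sup>2 = (cmod c * norm x)\<^sup>2"
    using of_real_eq_iff by blast
  then show ?thesis
    by (simp add: power2_eq_iff_nonneg)
qed

section \<open>Pythagoras, orthogonal projection and Cauchy-Schwarz\<close>

lemma norm_add_orthogonal:
  "cinner x y = 0 \<Longrightarrow> (norm (x + y::'a::complex_hilbert))\<^sup>2 = (norm x)\<^sup>2 + (norm y)\<^sup>2"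
  using cinner_eq_zero_commute[of x y]
  by (simp add: power2_norm_eq_cinner cinner_add_left cinner_add_right)

lemma norm_add_sq:
  "(norm (x + y::'a::complex_hilbert))\<^sup>2 = (norm x)\<^sup>2 + (norm y)\<^sup>2 + 2 * Re (cinner x y)"
proof -
  have "Re (cinner y x) = Re (cinner x y)"
    by (simp add: cinner_commute[of y x])
  then show ?thesis
    by (simp add: power2_norm_eq_cinner cinner_add_left cinner_add_right)
qed

lemma parallelogram:
  "(norm (x - y::'a::complex_hilbert))\<^sup>2 = 2 * (norm x)\<^sup>2 + 2 * (norm y)\<^sup>2 - (norm (x + y))\<^sup>2"
  using norm_add_sq[of x y] norm_add_sq[of x "- y"] by simp

text \<open>One Gram-Schmidt step. The case \<open>y = 0\<close> is included, since the inner
  product with 0 vanishes whatever the quotient is.\<close>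

lemma cinner_orthogonal_part:
  fixes x y :: "'a::complex_hilbert"
  shows "cinner y (x - (cinner y x / cinner y y) *\<^sub>C y) = 0"
  by (cases "y = 0") (auto simp: cinner_diff_right cinner_scaleC_right)

lemma norm_orthogonal_part:
  fixes x y :: "'a::complex_hilbert"
  defines "c \<equiv> cinner y x / cinner y y"
  shows "(norm x)\<^sup>2 = (norm (x - c *\<^sub>C y))\<^sup>2 + (norm (c *\<^sub>C y))\<^sup>2"
proof -
  have "cinner (x - c *\<^sub>C y) (c *\<^sub>C y) = 0"
    using cinner_orthogonal_part[of y x] cinner_eq_zero_commute[of y "x - c *\<^sub>C y"]
    by (simp add: c_def cinner_scaleC_right)
  from norm_add_orthogonal[OF this] show ?thesis
    by simp
qed

text \<open>The projection of \<open>y\<close> onto the line of \<open>x\<close> is no longer than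
  \<open>y\<close>; multiplying by \<open>norm x\<close> clears the denominator of the
  coefficient.\<close>

lemma cinner_Cauchy_Schwarz: "cmod (cinner x (y::'a::complex_hilbert)) \<le> norm x * norm y"
proof (cases "x = 0")
  case False
  define c where "c = cinner x y / cinner x x"
  have "(norm (c *\<^sub>C x))\<^sup>2 \<le> (norm y)\<^sup>2"
    using norm_orthogonal_part[of y x] by (simp add: c_def)
  then have "cmod c * norm x \<le> norm y"
    by (simp add: norm_scaleC power2_le_iff_abs_le)
  then have "norm x * (cmod c * norm x) \<le> norm x * norm y"
    by (intro mult_left_mono) auto
  moreover have "cmod (cinner x y) = norm x * (cmod c * norm x)"
    using False by (simp add: c_def norm_divide cinner_norm power2_eq_square norm_mult)
  ultimately show ?thesis
    by simp
qed simp

text \<open>Sesquilinear over the complex numbers, the form is bilinear over the reals, which gives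
  access to the library on real bounded bilinear maps.\<close>

lemma bounded_bilinear_cinner: "bounded_bilinear (cinner :: 'a::complex_hilbert \<Rightarrow> _)"
  by (intro bounded_bilinear.intro exI[of _ 1])
    (auto simp: cinner_add_left cinner_add_right cinner_scaleR_left cinner_scaleR_right
      cinner_Cauchy_Schwarz)

lemmas continuous_on_cinner [continuous_intros] =
  bounded_bilinear.continuous_on[OF bounded_bilinear_cinner]

lemma bounded_linear_scaleC: "bounded_linear (\<lambda>x::'a::complex_hilbert. c *\<^sub>C x)"
  by (rule bounded_linear_intro[of _ "cmod c"])
    (auto simp: scaleC_add_right scaleR_scaleC scaleC_scaleC norm_scaleC mult.commute)

lemma cinner_ext:
  assumes "\<And>u. cinner u y = cinner u z"
  shows "y = (z::'a::complex_hilbert)"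
proof -
  have "cinner (y - z) (y - z) = 0"
    by (simp add: cinner_diff_right assms)
  then show ?thesis
    by simp
qed

text \<open>The representing vector is a multiple of the vector of least norm in \<open>{x. f x = 1}\<close>.\<close>

theorem Riesz_representation:
  fixes f :: "'a::complex_hilbert \<Rightarrow> complex"
  assumes "bounded_linear f" and f_scaleC: "\<And>c x. f (c *\<^sub>C x) = c * f x"
  shows "\<exists>z. \<forall>x. f x = cinner z x"
proof (cases "\<forall>x. f x = 0")
  case True
  then show ?thesis by (intro exI[of _ 0]) auto
next
  case False
  interpret bounded_linear f by fact
  define C where "C = {x. f x = 1}"
  obtain x0 where "f x0 \<noteq> 0" using False by blast
  then have "(1 / f x0) *\<^sub>C x0 \<in> C"
    by (simp add: C_def f_scaleC)
  then have ne: "C \<noteq> {}"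
    by blast
  have cl: "closed C"
    unfolding C_def by (intro closed_Collect_eq continuous_on continuous_intros)
  define d where "d = Inf (norm ` C)"
  have bdd: "bdd_below (norm ` C)" by (intro bdd_belowI[of _ 0]) auto
  have d_le: "d \<le> norm x" if "x \<in> C" for x
    unfolding d_def using that bdd by (intro cInf_lower) auto
  have d0: "0 \<le> d"
    unfolding d_def using ne by (intro cInf_greatest) auto
  have "\<exists>x\<in>C. norm x < d + inverse (real (Suc n))" for n
    using cInf_lessD[of "norm ` C" "d + inverse (real (Suc n))"] ne by (auto simp: d_def)
  then obtain X where X: "\<And>n. X n \<in> C" "\<And>n. norm (X n) < d + inverse (real (Suc n))"
    by metis
  have "(\<lambda>n. norm (X n)) \<longlonglongrightarrow> d"
  proof (rule tendsto_sandwich[of "\<lambda>_. d" _ _ "\<lambda>n. d + inverse (real (Suc n))"])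
    show "(\<lambda>n. d + inverse (real (Suc n))) \<longlonglongrightarrow> d"
      using tendsto_add[OF tendsto_const LIMSEQ_inverse_real_of_nat, of d] by simp
    show "\<forall>\<^sub>F n in sequentially. norm (X n) \<le> d + inverse (real (Suc n))"
      using X(2) less_imp_le by (intro always_eventually) blast
    show "\<forall>\<^sub>F n in sequentially. d \<le> norm (X n)"
      using X(1) d_le by (intro always_eventually) blast
  qed simp
  then have sq: "(\<lambda>n. (norm (X n))\<^sup>2) \<longlonglongrightarrow> d\<^sup>2"
    by (rule tendsto_power)
  have "Cauchy X"
  proof (rule CauchyI)
    fix e :: real assume e: "0 < e"
    then obtain N where N: "\<And>n. n \<ge> N \<Longrightarrow> \<bar>(norm (X n))\<^sup>2 - d\<^sup>2\<bar> < e\<^sup>2 / 4"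
      using LIMSEQ_D[OF sq, of "e\<^sup>2 / 4"] by auto
    have "norm (X m - X n) < e" if "m \<ge> N" "n \<ge> N" for m n
    proof -
      \<comment> \<open>The midpoint stays in the affine set \<open>C\<close>, so its norm is at
        least \<open>d\<close>, and the parallelogram law bounds the distance of two nearly minimal
        vectors. The two tolerances \<open>e\<^sup>2 / 4\<close>, each doubled, add up to
        \<open>e\<^sup>2\<close>.\<close>
      have "(1 / 2) *\<^sub>R (X m + X n) \<in> C"
        using X(1) by (simp add: C_def scaleR add scaleR_conv_of_real)
      from power_mono[OF d_le[OF this] d0, of 2]
      have "4 * d\<^sup>2 \<le> (norm (X m + X n))\<^sup>2"
        by (simp add: power_divide)
      with N[OF that(1)] N[OF that(2)] have "(norm (X m - X n))\<^sup>2 < e\<^sup>2"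
        unfolding parallelogram[of "X m"] by linarith
      then show ?thesis
        using e by (simp add: power2_less_imp_less)
    qed
    then show "\<exists>M. \<forall>m\<ge>M. \<forall>n\<ge>M. norm (X m - X n) < e" by blast
  qed
  then obtain z where z: "X \<longlonglongrightarrow> z"
    using Cauchy_convergent convergent_def by blast
  have "z \<in> C"
    using closed_sequentially[OF cl X(1) z] .
  then have fz: "f z = 1" by (simp add: C_def)
  have "norm z = d"
    using LIMSEQ_unique[OF tendsto_norm[OF z] \<open>(\<lambda>n. norm (X n)) \<longlonglongrightarrow> d\<close>] .
  have orth: "cinner z h = 0" if "f h = 0" for h
  proof -
    define c where "c = cinner h z / cinner h h"
    \<comment> \<open>Moving \<open>z\<close> along the kernel of \<open>f\<close> stays in
      \<open>C\<close>; subtracting the projection onto \<open>h\<close> would shorten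
      \<open>z\<close> unless that projection is 0.\<close>
    have "z - c *\<^sub>C h \<in> C"
      using that fz by (simp add: C_def diff f_scaleC)
    then have "(norm z)\<^sup>2 \<le> (norm (z - c *\<^sub>C h))\<^sup>2"
      using d_le \<open>norm z = d\<close> by (intro power_mono) auto
    then have "c *\<^sub>C h = 0"
      using norm_orthogonal_part[of z h] by (simp add: c_def)
    then have "cinner h z = 0"
      using cinner_orthogonal_part[of h z] by (simp add: c_def)
    then show ?thesis by (simp add: cinner_eq_zero_commute)
  qed
  have "f x = cinner ((1 / cinner z z) *\<^sub>C z) x" for x
  proof -
    have "cinner z (x - f x *\<^sub>C z) = 0"
      by (rule orth) (simp add: diff f_scaleC fz)
    moreover have "z \<noteq> 0" using fz zero by auto
    moreover have "cnj (cinner z z) = cinner z z"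
      by (rule cinner_commute[symmetric])
    ultimately show ?thesis
      by (simp add: cinner_diff_right cinner_scaleC_right cinner_scaleC_left field_simps)
  qed
  then show ?thesis by blast
qed


section \<open>Bounded operators and their adjoints\<close>

lemma bounded_clinearD:
  assumes "bounded_clinear T"
  shows "bounded_linear T" and "T (c *\<^sub>C x) = c *\<^sub>C T x" and "T (x + y) = T x + T y"
    and "T (x - y) = T x - T y" and "T 0 = 0" and "T (- x) = - T x" and "T (r *\<^sub>R x) = r *\<^sub>R T x"
proof -
  show *: "bounded_linear T"
    using assms by (simp add: bounded_clinear_def)
  interpret bounded_linear T by fact
  show "T (c *\<^sub>C x) = c *\<^sub>C T x"
    using assms by (simp add: bounded_clinear_def)
  show "T (x + y) = T x + T y" "T (x - y) = T x - T y" "T 0 = 0" "T (- x) = - T x"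
    "T (r *\<^sub>R x) = r *\<^sub>R T x"
    by (fact add diff zero neg scaleR)+
qed

lemma bounded_clinear_id [simp]: "bounded_clinear id" "bounded_clinear (\<lambda>x. x)"
  by (auto simp: bounded_clinear_def id_def)

lemma bounded_clinear_zero [simp]: "bounded_clinear (\<lambda>x. 0)"
  by (auto simp: bounded_clinear_def)

lemma bounded_clinear_add:
  "bounded_clinear S \<Longrightarrow> bounded_clinear T \<Longrightarrow> bounded_clinear (\<lambda>x. S x + T x)"
  by (auto simp: bounded_clinear_def scaleC_add_right intro: bounded_linear_add)

lemma bounded_clinear_scaleC: "bounded_clinear T \<Longrightarrow> bounded_clinear (\<lambda>x. c *\<^sub>C T x)"
  by (auto simp: bounded_clinear_def scaleC_scaleC mult.commute
      intro: bounded_linear_compose[OF bounded_linear_scaleC])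

lemma bounded_clinear_comp:
  "bounded_clinear S \<Longrightarrow> bounded_clinear T \<Longrightarrow> bounded_clinear (S \<circ> T)"
  by (auto simp: bounded_clinear_def comp_def intro: bounded_linear_compose)

lemma cadjoint_eqI:
  assumes "bounded_clinear S" and "\<And>x y. cinner (T x) y = cinner x (S y)"
  shows "cadjoint T = S"
  unfolding cadjoint_def
proof (rule the_equality)
  fix S' assume "bounded_clinear S' \<and> (\<forall>x y. cinner (T x) y = cinner x (S' y))"
  then show "S' = S"
    by (intro ext cinner_ext) (simp add: assms(2)[symmetric])
qed (use assms in auto)

text \<open>Riesz, applied for each \<open>y\<close> to the functional that sends \<open>x\<close>
  to \<open>cinner y (T x)\<close>. Boundedness follows from \<open>norm (S y)\<close> squared being
  the modulus of \<open>cinner y (T (S y))\<close>, after cancelling one factor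
  \<open>norm (S y)\<close>.\<close>

lemma adjoint_exists:
  fixes T :: "'a::complex_hilbert \<Rightarrow> 'a"
  assumes T: "bounded_clinear T"
  shows "\<exists>S. bounded_clinear S \<and> (\<forall>x y. cinner (T x) y = cinner x (S y))"
proof -
  have "\<exists>z. \<forall>x. cinner y (T x) = cinner z x" for y
  proof (rule Riesz_representation)
    show "bounded_linear (\<lambda>x. cinner y (T x))"
      using bounded_linear_compose[OF bounded_bilinear.bounded_linear_right[OF bounded_bilinear_cinner]
          bounded_clinearD(1)[OF T]] .
  qed (simp add: bounded_clinearD[OF T] cinner_scaleC_right)
  then obtain S where S: "\<And>x y. cinner y (T x) = cinner (S y) x"
    by metis
  have S': "cinner (T x) y = cinner x (S y)" for x y
    using S[of y x] by (metis cinner_commute)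
  have add: "S (y + z) = S y + S z" for y z
    by (rule cinner_ext) (simp add: S'[symmetric] cinner_add_right)
  have scale: "S (c *\<^sub>C y) = c *\<^sub>C S y" for c y
    by (rule cinner_ext) (simp add: S'[symmetric] cinner_scaleC_right)
  obtain K where K: "\<And>x. norm (T x) \<le> norm x * K"
    using bounded_linear.bounded[OF bounded_clinearD(1)[OF T]] by blast
  have "norm (S y) \<le> norm y * K" for y
  proof (cases "S y = 0")
    case False
    have "norm (S y) * norm (S y) = cmod (cinner y (T (S y)))"
      by (simp add: S cinner_norm norm_mult power2_eq_square)
    also have "\<dots> \<le> norm y * (norm (S y) * K)"
      by (rule order_trans[OF cinner_Cauchy_Schwarz]) (intro mult_left_mono K, simp)
    finally show ?thesis
      using False by (simp add: mult.left_commute[of "norm y"])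
  next
    case True
    have "0 \<le> norm y * K"
      using K[of y] norm_ge_zero order_trans by blast
    then show ?thesis using True by simp
  qed
  then have "bounded_linear S"
    by (intro bounded_linear_intro[of _ K]) (auto simp: add scaleR_scaleC scale)
  then show ?thesis
    using scale S' by (auto simp: bounded_clinear_def)
qed

lemma
  assumes "bounded_clinear T"
  shows bounded_clinear_cadjoint: "bounded_clinear (cadjoint T)"
    and cinner_cadjoint: "cinner x (cadjoint T y) = cinner (T x) y"
proof -
  obtain S where "bounded_clinear S" "\<And>x y. cinner (T x) y = cinner x (S y)"
    using adjoint_exists[OF assms] by blast
  with cadjoint_eqI[of S T]
  show "bounded_clinear (cadjoint T)" "cinner x (cadjoint T y) = cinner (T x) y"
    by simp_all
qed

lemma cinner_cadjoint_left:
  assumes "bounded_clinear T"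
  shows "cinner (cadjoint T x) y = cinner x (T y)"
  using cinner_cadjoint[OF assms, of y x] cinner_commute[of "cadjoint T x" y]
    cinner_commute[of x "T y"] by simp

lemma cadjoint_id: "cadjoint id = id"
  by (intro cadjoint_eqI) auto

lemma cadjoint_cadjoint: "bounded_clinear T \<Longrightarrow> cadjoint (cadjoint T) = T"
  by (intro cadjoint_eqI) (auto simp: cinner_cadjoint_left)

lemma cadjoint_comp:
  "bounded_clinear S \<Longrightarrow> bounded_clinear T \<Longrightarrow> cadjoint (S \<circ> T) = cadjoint T \<circ> cadjoint S"
  by (intro cadjoint_eqI) (auto simp: cinner_cadjoint bounded_clinear_comp bounded_clinear_cadjoint)


section \<open>Commutants and generated C*-algebras\<close>

lemma commutantI:
  "bounded_clinear T \<Longrightarrow> (\<And>R x. R \<in> M \<Longrightarrow> T (R x) = R (T x)) \<Longrightarrow> T \<in> commutant M"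
  by (auto simp: commutant_def fun_eq_iff)

lemma commutantD:
  assumes "T \<in> commutant M"
  shows "bounded_clinear T" and "R \<in> M \<Longrightarrow> T (R x) = R (T x)"
  using assms by (auto simp: commutant_def fun_eq_iff)

lemma LIMSEQ_onorm:
  assumes "\<And>n. bounded_linear (F n)" "bounded_linear T"
    and "(\<lambda>n::nat. onorm (\<lambda>x. F n x - T x)) \<longlonglongrightarrow> 0"
  shows "(\<lambda>n. F n x) \<longlonglongrightarrow> T x"
proof -
  have "(\<lambda>n. onorm (\<lambda>x. F n x - T x) * norm x) \<longlonglongrightarrow> 0"
    using tendsto_mult_left_zero[OF assms(3)] .
  moreover have "norm (F n x - T x) \<le> onorm (\<lambda>x. F n x - T x) * norm x" for n
    using onorm[OF bounded_linear_sub[OF assms(1) assms(2)]] .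
  ultimately have "(\<lambda>n. F n x - T x) \<longlonglongrightarrow> 0"
    by (intro Lim_null_comparison[of "\<lambda>n. F n x - T x"]) (auto intro: always_eventually)
  then show ?thesis
    using LIM_zero_iff by blast
qed

text \<open>For adjoints, start from the relation of \<open>T\<close> with
  \<open>cadjoint R\<close>, which lies in \<open>M\<close>, and take adjoints of both sides. For
  limits, norm convergence gives pointwise convergence, and each \<open>R\<close> is
  continuous.\<close>

lemma cstar_subalgebra_commutant:
  assumes M: "\<And>R. R \<in> M \<Longrightarrow> bounded_clinear R" and adj: "\<And>R. R \<in> M \<Longrightarrow> cadjoint R \<in> M"
  shows "cstar_subalgebra (commutant M)"
proof -
  have adjoint: "cadjoint T \<in> commutant M" if T: "T \<in> commutant M" for T
  proof (rule commutantI)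
    fix R x assume R: "R \<in> M"
    have "T \<circ> cadjoint R = cadjoint R \<circ> T"
      using commutantD(2)[OF T adj[OF R]] by auto
    then have "cadjoint (T \<circ> cadjoint R) = cadjoint (cadjoint R \<circ> T)"
      by simp
    then have "R \<circ> cadjoint T = cadjoint T \<circ> R"
      using M[OF R] commutantD(1)[OF T]
      by (simp add: cadjoint_comp bounded_clinear_cadjoint cadjoint_cadjoint)
    then show "cadjoint T (R x) = R (cadjoint T x)"
      by (metis comp_apply)
  qed (use that commutantD(1) bounded_clinear_cadjoint in blast)
  have limit: "T \<in> commutant M"
    if F: "\<forall>n::nat. F n \<in> commutant M" and T: "bounded_clinear T"
      and lim: "(\<lambda>n. onorm (\<lambda>x. F n x - T x)) \<longlonglongrightarrow> 0" for F T
  proof (rule commutantI[OF T])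
    fix R x assume R: "R \<in> M"
    have *: "(\<lambda>n. F n y) \<longlonglongrightarrow> T y" for y
      by (rule LIMSEQ_onorm[OF bounded_clinearD(1)[OF commutantD(1)[OF F[rule_format]]] bounded_clinearD(1)[OF T] lim])
    have "(\<lambda>n. R (F n x)) \<longlonglongrightarrow> R (T x)"
      using bounded_linear.tendsto[OF bounded_clinearD(1)[OF M[OF R]] *] .
    then show "T (R x) = R (T x)"
      using LIMSEQ_unique[OF _ *[of "R x"]] by (simp add: commutantD(2)[OF F[rule_format] R])
  qed
  have closed: "(\<lambda>x. S x + T x) \<in> commutant M"
    "(\<lambda>x. c *\<^sub>C S x) \<in> commutant M" "S \<circ> T \<in> commutant M"
    if "S \<in> commutant M" "T \<in> commutant M" for S T c
    by (intro commutantI; simp add: commutantD(2)[OF that(1)] commutantD(2)[OF that(2)]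
        bounded_clinearD[OF M] bounded_clinear_add bounded_clinear_scaleC bounded_clinear_comp
        commutantD(1)[OF that(1)] commutantD(1)[OF that(2)])+
  have zero: "(\<lambda>x. 0) \<in> commutant M"
    by (intro commutantI) (auto simp: bounded_clinearD[OF M])
  show ?thesis
    unfolding cstar_subalgebra_def star_subalgebra_def
    by (intro conjI ballI allI impI)
      (assumption | rule adjoint zero commutantD(1) | rule closed, assumption, assumption
        | rule limit, assumption+)+
qed

section \<open>Generated C*-algebras and linear spans of operators\<close>

lemma cstar_generated_superset: "S \<subseteq> cstar_generated S"
  by (auto simp: cstar_generated_def)

lemma cstar_generated_minimal: "cstar_subalgebra B \<Longrightarrow> S \<subseteq> B \<Longrightarrow> cstar_generated S \<subseteq> B"
  by (auto simp: cstar_generated_def)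

text \<open>The commutant of the empty set is the algebra of all bounded operators. It is a member
  of the family being intersected; an empty family would have intersection
  \<open>UNIV\<close>.\<close>

lemma cstar_generated_bounded_clinear:
  assumes "\<And>T. T \<in> S \<Longrightarrow> bounded_clinear T" and "T \<in> cstar_generated S"
  shows "bounded_clinear T"
proof -
  have "S \<subseteq> commutant {}"
    by (rule subsetI, rule commutantI, erule assms) simp
  then have "cstar_generated S \<subseteq> commutant {}"
    by (rule cstar_generated_minimal[rotated]) (rule cstar_subalgebra_commutant, simp_all)
  from commutantD(1)[OF subsetD[OF this assms(2)]] show ?thesis .
qed

lemma star_subalgebraD:
  assumes "star_subalgebra B"
  shows "S \<in> B \<Longrightarrow> bounded_clinear S" and "(\<lambda>x. 0) \<in> B"
    and "S \<in> B \<Longrightarrow> T \<in> B \<Longrightarrow> (\<lambda>x. S x + T x) \<in> B"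
    and "S \<in> B \<Longrightarrow> (\<lambda>x. c *\<^sub>C S x) \<in> B"
    and "S \<in> B \<Longrightarrow> T \<in> B \<Longrightarrow> S \<circ> T \<in> B"
    and "S \<in> B \<Longrightarrow> cadjoint S \<in> B"
proof -
  note B = assms[unfolded star_subalgebra_def]
  show "S \<in> B \<Longrightarrow> bounded_clinear S" using B by simp
  show "(\<lambda>x. 0) \<in> B" using B by simp
  show "S \<in> B \<Longrightarrow> T \<in> B \<Longrightarrow> (\<lambda>x. S x + T x) \<in> B" using B by simp
  show "S \<in> B \<Longrightarrow> (\<lambda>x. c *\<^sub>C S x) \<in> B" using B by simp
  show "S \<in> B \<Longrightarrow> T \<in> B \<Longrightarrow> S \<circ> T \<in> B" using B by simp
  show "S \<in> B \<Longrightarrow> cadjoint S \<in> B" using B by simp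
qed

lemma cadjoint_in_cstar_generated:
  assumes "T \<in> cstar_generated S"
  shows "cadjoint T \<in> cstar_generated S"
  unfolding cstar_generated_def
proof (rule InterI)
  fix B assume B: "B \<in> {B. cstar_subalgebra B \<and> S \<subseteq> B}"
  have "T \<in> B"
    using InterD[OF assms[unfolded cstar_generated_def] B] .
  with B show "cadjoint T \<in> B"
    by (simp add: cstar_subalgebra_def star_subalgebraD(6))
qed

text \<open>Every C*-subalgebra is a star subalgebra, so it suffices to reach \<open>S\<close> from
  \<open>G\<close> by finite algebraic operations, without norm limits.\<close>

lemma cstar_generated_subset:
  assumes "\<And>B. star_subalgebra B \<Longrightarrow> G \<subseteq> B \<Longrightarrow> S \<subseteq> B"
  shows "cstar_generated S \<subseteq> cstar_generated G"
  unfolding cstar_generated_def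
  by (rule Inter_anti_mono) (use assms in \<open>auto simp: cstar_subalgebra_def\<close>)

text \<open>Lets an operation on elements of the generated algebra be carried out separately inside
  each \<open>B\<close> of the intersection.\<close>

lemma cstar_generatedI:
  assumes "\<And>B. star_subalgebra B \<Longrightarrow> cstar_generated S \<subseteq> B \<Longrightarrow> T \<in> B"
  shows "T \<in> cstar_generated S"
  unfolding cstar_generated_def
proof (rule InterI)
  fix B assume "B \<in> {B. cstar_subalgebra B \<and> S \<subseteq> B}"
  then show "T \<in> B"
    using assms[of B] cstar_generated_minimal[of B S] by (simp add: cstar_subalgebra_def)
qed

lemma star_subalgebra_cstar_generated:
  assumes "\<And>T. T \<in> S \<Longrightarrow> bounded_clinear T"
  shows "star_subalgebra (cstar_generated S)"
  unfolding star_subalgebra_def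
proof (intro conjI ballI allI)
  fix R T and c assume "R \<in> cstar_generated S" "T \<in> cstar_generated S"
  note RT = subsetD[OF _ this(1)] subsetD[OF _ this(2)]
  show "(\<lambda>x. R x + T x) \<in> cstar_generated S" "R \<circ> T \<in> cstar_generated S"
    by (rule cstar_generatedI, rule star_subalgebraD(3,5), assumption; rule RT, assumption)+
next
  fix R c assume "R \<in> cstar_generated S"
  note R = subsetD[OF _ this]
  show "(\<lambda>x. c *\<^sub>C R x) \<in> cstar_generated S"
    by (rule cstar_generatedI, rule star_subalgebraD(4), assumption, rule R, assumption)
next
  show "(\<lambda>x. 0) \<in> cstar_generated S"
    by (rule cstar_generatedI, rule star_subalgebraD(2))
qed (rule cstar_generated_bounded_clinear[OF assms] cadjoint_in_cstar_generated; assumption)+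

lemma op_span_induct [consumes 1, case_names zero step]:
  assumes "T \<in> op_span S" and "P (\<lambda>x. 0)"
    and "\<And>R c T. R \<in> S \<Longrightarrow> P T \<Longrightarrow> P (\<lambda>x. T x + c *\<^sub>C R x)"
  shows "P T"
proof -
  obtain n :: nat and c F where T: "T = (\<lambda>x. \<Sum>i<n. c i *\<^sub>C F i x)" and F: "\<And>i. i < n \<Longrightarrow> F i \<in> S"
    using assms(1) by (auto simp: op_span_def)
  have "P (\<lambda>x. \<Sum>i<m. c i *\<^sub>C F i x)" if "m \<le> n" for m
    using that
  proof (induction m)
    case (Suc m)
    then show ?case
      using assms(3)[OF F[of m] Suc.IH, of "c m"] by simp
  qed (use assms(2) in simp)
  then show ?thesis
    using T by blast
qed

lemma op_span_superset: "S \<subseteq> op_span S"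
proof
  fix T assume "T \<in> S"
  then show "T \<in> op_span S"
    unfolding op_span_def
    by (intro CollectI exI[of _ "1::nat"] exI[of _ "\<lambda>_. 1"] exI[of _ "\<lambda>_. T"]) auto
qed

lemma op_span_subset:
  assumes "star_subalgebra B" "S \<subseteq> B"
  shows "op_span S \<subseteq> B"
proof
  fix T assume "T \<in> op_span S"
  then show "T \<in> B"
  proof (induction rule: op_span_induct)
    case (step R c T)
    then show ?case
      using assms star_subalgebraD(3,4)[OF assms(1)] by blast
  qed (use assms star_subalgebraD in blast)
qed

lemma star_subalgebra_bounded: "star_subalgebra {T. bounded_clinear T}"
  by (auto simp: star_subalgebra_def bounded_clinear_add bounded_clinear_scaleC
      bounded_clinear_comp bounded_clinear_cadjoint)


section \<open>Hilbert space tensor products\<close>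

lemma norm_sum_orthogonal:
  fixes f :: "nat \<Rightarrow> 'a::complex_hilbert"
  assumes "\<And>i j. i < n \<Longrightarrow> j < n \<Longrightarrow> i \<noteq> j \<Longrightarrow> cinner (f i) (f j) = 0"
  shows "(norm (\<Sum>i<n. f i))\<^sup>2 = (\<Sum>i<n. (norm (f i))\<^sup>2)"
  using assms
proof (induction n)
  case (Suc n)
  have "cinner (\<Sum>i<n. f i) (f n) = 0"
    using Suc.prems by (simp add: cinner_sum_left)
  with norm_add_orthogonal[OF this] Suc show ?case
    by simp
qed simp

text \<open>The map is given as a graph because on sums of simple tensors its values are not known
  to be independent of the representation. The bound forces this, as it leaves only
  \<open>z = 0\<close> over \<open>x = 0\<close>, and it also yields the continuous
  extension.\<close>

lemma bounded_graph_extension: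
  fixes G :: "('a::real_normed_vector \<times> 'b::banach) set"
  assumes G: "subspace G" and bound: "\<And>x z. (x, z) \<in> G \<Longrightarrow> norm z \<le> K * norm x"
    and dense: "closure (fst ` G) = UNIV"
  shows "\<exists>T. bounded_linear T \<and> (\<forall>(x, z)\<in>G. T x = z)"
proof -
  have "\<exists>p. (\<forall>n::nat. p n \<in> G) \<and> (\<lambda>n. fst (p n)) \<longlonglongrightarrow> x" for x
  proof -
    have "x \<in> closure (fst ` G)" using dense by simp
    then obtain a where a: "\<And>n::nat. a n \<in> fst ` G" "a \<longlonglongrightarrow> x"
      unfolding closure_sequential by blast
    then have "\<forall>n. \<exists>q. q \<in> G \<and> fst q = a n" by (metis imageE)
    then obtain p where p: "\<And>n. p n \<in> G" "\<And>n. fst (p n) = a n" by metis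
    then show ?thesis using a(2) by (intro exI[of _ p]) simp
  qed
  then obtain P where P: "\<And>x n. P x n \<in> G" "\<And>x. (\<lambda>n::nat. fst (P x n)) \<longlonglongrightarrow> x"
    by metis
  have diff: "norm (snd p - snd q) \<le> K * norm (fst p - fst q)" if "p \<in> G" "q \<in> G" for p q
    using subspace_diff[OF G that] bound[of "fst p - fst q" "snd p - snd q"]
    by (simp add: minus_prod_def)
  have "convergent (\<lambda>n. snd (P x n))" for x
  proof -
    have "Cauchy (\<lambda>n. snd (P x n))"
    proof (rule CauchyI)
      fix e :: real assume "0 < e"
      \<comment> \<open>\<open>K\<close> may be zero or negative; \<open>\<bar>K\<bar> + 1\<close>
        is a positive constant above it.\<close>
      then have "0 < e / (\<bar>K\<bar> + 1)" by simp
      then obtain M where M: "\<And>m n. m \<ge> M \<Longrightarrow> n \<ge> M \<Longrightarrow>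
          norm (fst (P x m) - fst (P x n)) < e / (\<bar>K\<bar> + 1)"
        using CauchyD[OF LIMSEQ_imp_Cauchy[OF P(2)]] by blast
      have "norm (snd (P x m) - snd (P x n)) < e" if mn: "m \<ge> M" "n \<ge> M" for m n
      proof -
        let ?d = "norm (fst (P x m) - fst (P x n))"
        have "norm (snd (P x m) - snd (P x n)) \<le> K * ?d"
          by (rule diff[OF P(1) P(1)])
        also have "\<dots> \<le> (\<bar>K\<bar> + 1) * ?d"
          by (intro mult_right_mono) auto
        also have "\<dots> < e"
          using M[OF mn] by (simp add: pos_less_divide_eq mult.commute)
        finally show ?thesis .
      qed
      then show "\<exists>M. \<forall>m\<ge>M. \<forall>n\<ge>M. norm (snd (P x m) - snd (P x n)) < e" by blast
    qed
    then show ?thesis by (rule Cauchy_convergent)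
  qed
  then obtain T where T: "\<And>x. (\<lambda>n. snd (P x n)) \<longlonglongrightarrow> T x"
    unfolding convergent_def by metis
  \<comment> \<open>The limit does not depend on the chosen sequence \<open>P x\<close>. Additivity,
    homogeneity and, with a constant sequence, agreement with \<open>G\<close> all follow from
    this.\<close>
  have lim: "(\<lambda>n. snd (q n)) \<longlonglongrightarrow> T x"
    if q: "\<And>n. q n \<in> G" "(\<lambda>n. fst (q n)) \<longlonglongrightarrow> x" for q x
  proof -
    have "(\<lambda>n. K * norm (fst (q n) - fst (P x n))) \<longlonglongrightarrow> K * norm (x - x)"
      by (intro tendsto_intros q P)
    then have "(\<lambda>n. K * norm (fst (q n) - fst (P x n))) \<longlonglongrightarrow> 0"
      by simp
    then have "(\<lambda>n. snd (q n) - snd (P x n)) \<longlonglongrightarrow> 0"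
      by (rule Lim_null_comparison[rotated]) (intro always_eventually allI diff q P)
    from tendsto_add[OF this T[of x]] show ?thesis by simp
  qed
  have "T (x + y) = T x + T y" for x y
  proof (rule LIMSEQ_unique)
    show "(\<lambda>n. snd (P x n + P y n)) \<longlonglongrightarrow> T (x + y)"
      using P by (intro lim subspace_add[OF G]) (auto intro!: tendsto_add)
    show "(\<lambda>n. snd (P x n + P y n)) \<longlonglongrightarrow> T x + T y"
      using tendsto_add[OF T T] by simp
  qed
  moreover have "T (r *\<^sub>R x) = r *\<^sub>R T x" for r x
  proof (rule LIMSEQ_unique)
    show "(\<lambda>n. snd (r *\<^sub>R P x n)) \<longlonglongrightarrow> T (r *\<^sub>R x)"
      using P by (intro lim subspace_scale[OF G]) (auto intro!: tendsto_scaleR)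
    show "(\<lambda>n. snd (r *\<^sub>R P x n)) \<longlonglongrightarrow> r *\<^sub>R T x"
      using tendsto_scaleR[OF tendsto_const T] by simp
  qed
  moreover have "norm (T x) \<le> norm x * K" for x
  proof (rule LIMSEQ_le)
    show "(\<lambda>n. norm (snd (P x n))) \<longlonglongrightarrow> norm (T x)"
      by (intro tendsto_norm T)
    show "(\<lambda>n. norm (fst (P x n)) * K) \<longlonglongrightarrow> norm x * K"
      by (intro tendsto_intros P)
    have "norm (snd (P x n)) \<le> norm (fst (P x n)) * K" for n
      using bound[of "fst (P x n)" "snd (P x n)"] P(1) by (simp add: mult.commute)
    then show "\<exists>N. \<forall>n\<ge>N. norm (snd (P x n)) \<le> norm (fst (P x n)) * K" by blast
  qed
  ultimately have "bounded_linear T"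
    by (rule bounded_linear_intro)
  moreover have "T x = z" if "(x, z) \<in> G" for x z
    using lim[of "\<lambda>_. (x, z)" x] that LIMSEQ_unique[OF tendsto_const, of z "T x"] by simp
  ultimately show ?thesis by blast
qed

lemma bounded_linear_dense_ext:
  fixes F F' :: "'a::real_normed_vector \<Rightarrow> 'b::real_normed_vector"
  assumes "bounded_linear F" "bounded_linear F'" "closure W = UNIV" "\<And>x. x \<in> W \<Longrightarrow> F x = F' x"
  shows "F = F'"
proof -
  have "closed {x. F x = F' x}"
    by (intro closed_Collect_eq linear_continuous_on assms(1,2))
  then have "closure W \<subseteq> {x. F x = F' x}"
    using assms(4) by (intro closure_minimal) auto
  then show ?thesis
    using assms(3) by auto
qed

locale hilbert_tensor_product =
  fixes t :: "'a::complex_hilbert \<Rightarrow> 'b::complex_hilbert \<Rightarrow> 'c::complex_hilbert"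
  assumes tensor: "hilbert_tensor t"
begin

lemma t_add_left: "t (v + v') w = t v w + t v' w"
  and t_add_right: "t v (w + w') = t v w + t v w'"
  and t_scaleC_left: "t (c *\<^sub>C v) w = c *\<^sub>C t v w"
  and t_scaleC_right: "t v (c *\<^sub>C w) = c *\<^sub>C t v w"
  and cinner_t: "cinner (t v w) (t v' w') = cinner v v' * cinner w w'"
  and closure_sums: "closure {\<Sum>i<n. t (v i) (w i) | (n::nat) v w. True} = UNIV"
  using tensor unfolding hilbert_tensor_def by simp_all

lemma t_scaleR_left: "t (r *\<^sub>R v) w = r *\<^sub>R t v w"
  and t_scaleR_right: "t v (r *\<^sub>R w) = r *\<^sub>R t v w"
  by (simp_all add: scaleR_scaleC t_scaleC_left t_scaleC_right)

lemma norm_t: "norm (t v w) = norm v * norm w"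
proof -
  have "complex_of_real ((norm (t v w))\<^sup>2) = of_real ((norm v * norm w)\<^sup>2)"
    unfolding cinner_norm[symmetric] cinner_t by (simp add: cinner_norm power_mult_distrib)
  then have "(norm (t v w))\<^sup>2 = (norm v * norm w)\<^sup>2"
    using of_real_eq_iff by blast
  then show ?thesis
    by (simp add: power2_eq_iff_nonneg)
qed

lemma bounded_bilinear_t: "bounded_bilinear t"
  by (intro bounded_bilinear.intro exI[of _ 1])
    (auto simp: t_add_left t_add_right t_scaleR_left t_scaleR_right norm_t)

sublocale bt: bounded_bilinear t
  by (rule bounded_bilinear_t)

lemma closure_span_t: "closure (span (range (\<lambda>(v, w). t v w))) = UNIV"
proof -
  have "{\<Sum>i<n. t (v i) (w i) | (n::nat) v w. True} \<subseteq> span (range (\<lambda>(v, w). t v w))"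
  proof clarify
    fix n :: nat and v w
    show "(\<Sum>i<n. t (v i) (w i)) \<in> span (range (\<lambda>(v, w). t v w))"
      by (intro span_sum span_base) auto
  qed
  from closure_mono[OF this] show ?thesis
    using closure_sums by auto
qed

text \<open>The set where \<open>F\<close> and \<open>F'\<close> agree is a closed real subspace.
  Since only real linearity enters, antilinear maps can be compared in the same way.\<close>

lemma tensor_ext:
  fixes F F' :: "'c \<Rightarrow> 'd::real_normed_vector"
  assumes F: "bounded_linear F" "bounded_linear F'" and eq: "\<And>v w. F (t v w) = F' (t v w)"
  shows "F = F'"
proof -
  have "span (range (\<lambda>(v, w). t v w)) \<subseteq> {x. F x = F' x}"
  proof (rule span_minimal)
    show "subspace {x. F x = F' x}"
      using F by (auto simp: subspace_def linear_simps)
  qed (auto simp: eq)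
  moreover have "closed {x. F x = F' x}"
    by (intro closed_Collect_eq linear_continuous_on F)
  ultimately have "closure (span (range (\<lambda>(v, w). t v w))) \<subseteq> {x. F x = F' x}"
    by (rule closure_minimal)
  then show ?thesis
    unfolding closure_span_t by auto
qed

text \<open>Density is used in one leg at a time, with the other held fixed. This serves operators
  known only on tensors of vectors from the two Dirac domains.\<close>

lemma tensor_dense_ext:
  fixes F F' :: "'c \<Rightarrow> 'd::real_normed_vector"
  assumes F: "bounded_linear F" "bounded_linear F'"
    and V: "closure V = UNIV" and W: "closure W = UNIV"
    and eq: "\<And>v w. v \<in> V \<Longrightarrow> w \<in> W \<Longrightarrow> F (t v w) = F' (t v w)"
  shows "F = F'"
proof (rule tensor_ext[OF F])
  have left: "(\<lambda>v. F (t v w)) = (\<lambda>v. F' (t v w))" if "w \<in> W" for w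
    by (rule bounded_linear_dense_ext[OF _ _ V])
      (auto intro: bounded_linear_compose[OF F(1) bt.bounded_linear_left]
        bounded_linear_compose[OF F(2) bt.bounded_linear_left] eq that)
  have "F (t v w) = F' (t v w)" if "w \<in> W" for v w
    using left[OF that] by (rule fun_cong)
  then have "(\<lambda>w. F (t v w)) = (\<lambda>w. F' (t v w))" for v
    by (intro bounded_linear_dense_ext[OF _ _ W])
      (auto intro: bounded_linear_compose[OF F(1) bt.bounded_linear_right]
        bounded_linear_compose[OF F(2) bt.bounded_linear_right])
  then show "F (t v w) = F' (t v w)" for v w
    by (rule fun_cong)
qed

lemma cinner_tensor_eqI:
  assumes "\<And>v w. cinner (t v w) y = cinner (t v w) z"
  shows "y = z"
proof -
  have "(\<lambda>u. cinner u y) = (\<lambda>u. cinner u z)"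
    by (rule tensor_ext) (auto intro: bounded_bilinear.bounded_linear_left[OF bounded_bilinear_cinner] assms)
  then show ?thesis
    by (intro cinner_ext) (metis)
qed

text \<open>A finite sum of simple tensors can be rewritten, without leaving the graph of the map to be
  constructed, so that its second legs are orthogonal; then both norms are given by Pythagoras.\<close>

lemma tensor_lift:
  fixes f :: "'a \<Rightarrow> 'b \<Rightarrow> 'd::complex_hilbert"
  assumes add_left: "\<And>v v' w. f (v + v') w = f v w + f v' w"
    and add_right: "\<And>v w w'. f v (w + w') = f v w + f v w'"
    and scaleR: "\<And>r v w. f (r *\<^sub>R v) w = r *\<^sub>R f v w"
    and balanced: "\<And>c v w. f v (c *\<^sub>C w) = f (c *\<^sub>C v) w"
    and orthogonal: "\<And>v w v' w'. cinner w w' = 0 \<Longrightarrow> cinner (f v w) (f v' w') = 0"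
    and bound: "\<And>v w. norm (f v w) \<le> K * (norm v * norm w)" and K: "0 \<le> K"
  shows "\<exists>T. bounded_linear T \<and> (\<forall>v w. T (t v w) = f v w)"
proof -
  define G where "G = span (range (\<lambda>(v, w). (t v w, f v w)))"
  define rep where "rep p \<longleftrightarrow> (\<exists>(n::nat) v e.
      (\<forall>i<n. \<forall>j<n. i \<noteq> j \<longrightarrow> cinner (e i) (e j) = 0) \<and>
      fst p = (\<Sum>i<n. t (v i) (e i)) \<and> snd p = (\<Sum>i<n. f (v i) (e i)))" for p
  have rep: "rep p" if "p \<in> G" for p
    using that unfolding G_def
  proof (induction rule: span_induct_alt)
    case base
    show ?case unfolding rep_def by (intro exI[of _ 0]) simp
  next
    case (step r x y)
    then obtain u0 w where x: "x = (t u0 w, f u0 w)" by auto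
    obtain n :: nat and v :: "nat \<Rightarrow> 'a" and e :: "nat \<Rightarrow> 'b" where orth: "\<And>i j. i < n \<Longrightarrow> j < n \<Longrightarrow> i \<noteq> j \<Longrightarrow> cinner (e i) (e j) = 0"
      and y: "fst y = (\<Sum>i<n. t (v i) (e i))" "snd y = (\<Sum>i<n. f (v i) (e i))"
      using step(2) unfolding rep_def by (elim exE conjE) (rule that; simp)
    define u where "u = r *\<^sub>R u0"
    \<comment> \<open>The family \<open>e\<close> is orthogonal but not normalised, and members may
      be 0; the convention for division by 0 then gives coefficient 0.\<close>
    define k where "k i = cinner (e i) w / cinner (e i) (e i)" for i
    define s where "s = w - (\<Sum>i<n. k i *\<^sub>C e i)"
    have w: "w = s + (\<Sum>i<n. k i *\<^sub>C e i)" by (simp add: s_def)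
    have sum_right: "f v (\<Sum>i<n. g i) = (\<Sum>i<n. f v (g i))" for v g and n :: nat
    proof (induction n)
      case 0
      show ?case using add_right[of v 0 0] by simp
    qed (simp add: add_right)
    have s: "cinner (e i) s = 0" if "i < n" for i
    proof -
      have "cinner (e i) (\<Sum>j<n. k j *\<^sub>C e j) = (\<Sum>j<n. if j = i then k i * cinner (e i) (e i) else 0)"
        unfolding cinner_sum_right
        by (intro sum.cong) (auto simp: cinner_scaleC_right orth that)
      also have "\<dots> = cinner (e i) w"
        using that by (cases "e i = 0") (auto simp: k_def)
      finally show ?thesis by (simp add: s_def cinner_diff_right)
    qed
    \<comment> \<open>Splitting \<open>w\<close> along the family leaves the remainder
      \<open>s\<close> as the new last leg, while each coefficient \<open>k i\<close> moves to the
      first leg and joins \<open>v i\<close>. On the values of \<open>f\<close> this move is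
      \<open>balanced\<close>, which holds for linear and for antilinear pairs of maps
      alike.\<close>
    define v' where "v' i = (if i = n then u else v i + k i *\<^sub>C u)" for i
    define e' where "e' i = (if i = n then s else e i)" for i
    have "\<forall>i<Suc n. \<forall>j<Suc n. i \<noteq> j \<longrightarrow> cinner (e' i) (e' j) = 0"
    proof (intro allI impI)
      fix i j assume ij: "i < Suc n" "j < Suc n" "i \<noteq> j"
      then consider "i < n" "j < n" | "i = n" "j < n" | "i < n" "j = n" by linarith
      then show "cinner (e' i) (e' j) = 0"
        using orth[of i j] s[of i] s[of j] cinner_eq_zero_commute[of s "e j"] ij(3)
        by cases (auto simp: e'_def)
    qed
    moreover have "fst (r *\<^sub>R x + y) = (\<Sum>i<Suc n. t (v' i) (e' i))"
    proof -
      have "fst (r *\<^sub>R x + y) = t u w + (\<Sum>i<n. t (v i) (e i))"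
        by (simp add: x y u_def t_scaleR_left)
      also have "\<dots> = (\<Sum>i<n. t (v i + k i *\<^sub>C u) (e i)) + t u s"
        by (subst w) (simp add: bt.sum_right t_add_right t_add_left sum.distrib
            t_scaleC_right t_scaleC_left)
      finally show ?thesis by (simp add: v'_def e'_def)
    qed
    moreover have "snd (r *\<^sub>R x + y) = (\<Sum>i<Suc n. f (v' i) (e' i))"
    proof -
      have "snd (r *\<^sub>R x + y) = f u w + (\<Sum>i<n. f (v i) (e i))"
        by (simp add: x y u_def scaleR)
      also have "\<dots> = (\<Sum>i<n. f (v i + k i *\<^sub>C u) (e i)) + f u s"
        by (subst w) (simp add: sum_right add_right add_left sum.distrib balanced)
      finally show ?thesis by (simp add: v'_def e'_def)
    qed
    ultimately show ?case
      unfolding rep_def by (intro exI[of _ "Suc n"] exI[of _ v'] exI[of _ e'] conjI)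
  qed
  have "\<exists>T. bounded_linear T \<and> (\<forall>(x, z)\<in>G. T x = z)"
  proof (rule bounded_graph_extension)
    show "subspace G" unfolding G_def by (rule subspace_span)
    have "fst ` G = span (fst ` range (\<lambda>(v, w). (t v w, f v w)))"
      unfolding G_def by (rule linear_span_image[symmetric]) (rule linear_fst)
    also have "fst ` range (\<lambda>(v, w). (t v w, f v w)) = range (\<lambda>(v, w). t v w)"
      by (auto simp: image_image split_def)
    finally show "closure (fst ` G) = UNIV"
      using closure_span_t by simp
    fix x z assume "(x, z) \<in> G"
    from rep[OF this] obtain n :: nat and v :: "nat \<Rightarrow> 'a" and e :: "nat \<Rightarrow> 'b" where orth: "\<And>i j. i < n \<Longrightarrow> j < n \<Longrightarrow> i \<noteq> j \<Longrightarrow> cinner (e i) (e j) = 0"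
      and x: "x = (\<Sum>i<n. t (v i) (e i))" and z: "z = (\<Sum>i<n. f (v i) (e i))"
      unfolding rep_def by (elim exE conjE) (rule that; simp)
    have "(norm z)\<^sup>2 = (\<Sum>i<n. (norm (f (v i) (e i)))\<^sup>2)"
      unfolding z by (rule norm_sum_orthogonal) (intro orthogonal orth)
    also have "\<dots> \<le> (\<Sum>i<n. (K * norm (t (v i) (e i)))\<^sup>2)"
      using bound by (intro sum_mono power_mono) (auto simp: norm_t)
    also have "\<dots> = K\<^sup>2 * (\<Sum>i<n. (norm (t (v i) (e i)))\<^sup>2)"
      by (simp add: power_mult_distrib sum_distrib_left)
    also have "(\<Sum>i<n. (norm (t (v i) (e i)))\<^sup>2) = (norm x)\<^sup>2"
      unfolding x by (rule norm_sum_orthogonal[symmetric]) (simp add: cinner_t orth)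
    finally have "(norm z)\<^sup>2 \<le> (K * norm x)\<^sup>2"
      by (simp add: power_mult_distrib)
    then show "norm z \<le> K * norm x"
      using K by (simp add: power2_le_iff_abs_le)
  qed
  then obtain T where T: "bounded_linear T" "\<forall>(x, z)\<in>G. T x = z" by blast
  have "(t v w, f v w) \<in> G" for v w
    unfolding G_def by (intro span_base) auto
  from bspec[OF T(2) this] T(1) show ?thesis by auto
qed

end

lemma hilbert_tensor_flip:
  assumes "hilbert_tensor t"
  shows "hilbert_tensor (\<lambda>w v. t v w)"
proof -
  interpret hilbert_tensor_product t by unfold_locales fact
  have "{\<Sum>i<n. t (v i) (w i) | (n::nat) v w. True} = {\<Sum>i<n. t (v i) (w i) | (n::nat) w v. True}"
    by blast
  then show ?thesis
    using closure_sums unfolding hilbert_tensor_def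
    by (simp add: t_add_left t_add_right t_scaleC_left t_scaleC_right cinner_t mult.commute)
qed

section \<open>Tensor products of bounded operators\<close>

context hilbert_tensor_product
begin

text \<open>\<open>tensor_lift\<close> asks that orthogonal second legs stay orthogonal. Acting on
  the first leg alone respects this, whereas a general operator on the second leg would not.\<close>

lemma op_tensor_left_exists:
  assumes S: "bounded_clinear S"
  shows "\<exists>T. bounded_linear T \<and> (\<forall>v w. T (t v w) = t (S v) w)"
proof -
  obtain K where K: "0 \<le> K" "\<And>x. norm (S x) \<le> norm x * K"
    using bounded_linear.nonneg_bounded[OF bounded_clinearD(1)[OF S]] by blast
  show ?thesis
  proof (rule tensor_lift[OF _ _ _ _ _ _ K(1)])
    show "norm (t (S v) w) \<le> K * (norm v * norm w)" for v w
      using mult_right_mono[OF K(2)[of v], of "norm w"] by (simp add: norm_t mult_ac)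
  qed (simp_all add: bounded_clinearD[OF S] t_add_left t_add_right t_scaleR_left
      t_scaleC_left t_scaleC_right cinner_t)
qed

lemma op_tensor_eqI:
  assumes "bounded_clinear T" "\<And>v w. T (t v w) = t (S v) (R w)"
  shows "op_tensor t S R = T"
  unfolding op_tensor_def
proof (rule the_equality)
  fix T' assume "bounded_clinear T' \<and> (\<forall>v w. T' (t v w) = t (S v) (R w))"
  then show "T' = T"
    using assms by (intro tensor_ext) (simp_all add: bounded_clinearD(1))
qed (use assms in auto)

text \<open>The operator is the composite of one acting on the first leg and one acting on the
  second; the latter comes from the former by exchanging the roles of the legs.\<close>

lemma
  assumes S: "bounded_clinear S" and R: "bounded_clinear R"
  shows bounded_clinear_op_tensor: "bounded_clinear (op_tensor t S R)"
    and op_tensor_apply: "op_tensor t S R (t v w) = t (S v) (R w)"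
proof -
  interpret flip: hilbert_tensor_product "\<lambda>w v. t v w"
    by unfold_locales (rule hilbert_tensor_flip[OF tensor])
  obtain T1 where T1: "bounded_linear T1" "\<And>v w. T1 (t v w) = t (S v) w"
    using op_tensor_left_exists[OF S] by blast
  obtain T2 where T2: "bounded_linear T2" "\<And>v w. T2 (t v w) = t v (R w)"
    using flip.op_tensor_left_exists[OF R] by blast
  have bl: "bounded_linear (\<lambda>x. T1 (T2 x))"
    by (rule bounded_linear_compose[OF T1(1) T2(1)])
  \<comment> \<open>The lifts are so far only real linear; complex homogeneity is recovered by
    comparison on simple tensors.\<close>
  have "(\<lambda>x. T1 (T2 (c *\<^sub>C x))) = (\<lambda>x. c *\<^sub>C T1 (T2 x))" for c
  proof (rule tensor_ext)
    show "bounded_linear (\<lambda>x. T1 (T2 (c *\<^sub>C x)))" "bounded_linear (\<lambda>x. c *\<^sub>C T1 (T2 x))"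
      using bounded_linear_compose[OF bl bounded_linear_scaleC]
        bounded_linear_compose[OF bounded_linear_scaleC bl] by simp_all
    show "T1 (T2 (c *\<^sub>C t v w)) = c *\<^sub>C T1 (T2 (t v w))" for v w
      by (simp add: T1(2) T2(2) t_scaleC_left[symmetric] bounded_clinearD[OF S])
  qed
  then have "T1 (T2 (c *\<^sub>C x)) = c *\<^sub>C T1 (T2 x)" for c x
    by metis
  with bl have *: "bounded_clinear (\<lambda>x. T1 (T2 x))"
    by (simp add: bounded_clinear_def)
  have eq: "op_tensor t S R = (\<lambda>x. T1 (T2 x))"
    by (rule op_tensor_eqI[OF *]) (simp add: T1 T2)
  show "bounded_clinear (op_tensor t S R)" "op_tensor t S R (t v w) = t (S v) (R w)"
    unfolding eq by (simp_all add: * T1 T2)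
qed

lemma cadjoint_op_tensor:
  assumes "bounded_clinear S" "bounded_clinear R"
  shows "cadjoint (op_tensor t S R) = op_tensor t (cadjoint S) (cadjoint R)"
proof (rule tensor_ext)
  note bc = bounded_clinear_op_tensor bounded_clinear_cadjoint assms
  show "bounded_linear (cadjoint (op_tensor t S R))"
    "bounded_linear (op_tensor t (cadjoint S) (cadjoint R))"
    by (intro bounded_clinearD(1) bc)+
  show "cadjoint (op_tensor t S R) (t v w) = op_tensor t (cadjoint S) (cadjoint R) (t v w)" for v w
    by (rule cinner_tensor_eqI) (simp add: cinner_cadjoint op_tensor_apply bc cinner_t)
qed

end


section \<open>Conjugation by antiunitary maps\<close>

lemma
  assumes "antilinear_isometry J"
  shows antilinear_add: "J (x + y) = J x + J y"
    and antilinear_scaleC: "J (c *\<^sub>C x) = cnj c *\<^sub>C J x"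
    and antilinear_scaleR: "J (r *\<^sub>R x) = r *\<^sub>R J x"
    and antilinear_norm: "norm (J x) = norm x"
    and antilinear_bounded_linear: "bounded_linear J"
    and antilinear_inj: "inj J"
proof -
  show add: "\<And>x y. J (x + y) = J x + J y" and scaleC: "\<And>c x. J (c *\<^sub>C x) = cnj c *\<^sub>C J x"
    and norm: "\<And>x. norm (J x) = norm x"
    using assms by (simp_all add: antilinear_isometry_def)
  show scaleR: "\<And>r x. J (r *\<^sub>R x) = r *\<^sub>R J x"
    by (simp add: scaleR_scaleC scaleC)
  show bl: "bounded_linear J"
    by (rule bounded_linear_intro[of _ 1]) (simp_all add: add scaleR norm)
  interpret bounded_linear J by (rule bl)
  show "inj J"
  proof (rule injI)
    fix x y assume "J x = J y"
    then have "norm (J (x - y)) = 0" by (simp add: diff)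
    then show "x = y" by (simp add: norm)
  qed
qed

text \<open>Polarisation: norms determine the real part, and the real part at
  \<open>\<i> *\<^sub>C y\<close> gives the imaginary part, with its sign reversed by
  antilinearity.\<close>

lemma antilinear_cinner:
  assumes "antilinear_isometry J"
  shows "cinner (J x) (J y) = cnj (cinner x y)"
proof (rule complex_eqI)
  have Re: "Re (cinner (J x) (J y)) = Re (cinner x y)" for x y
    using norm_add_sq[of x y] norm_add_sq[of "J x" "J y"]
    by (simp add: antilinear_add[OF assms, symmetric] antilinear_norm[OF assms])
  show "Re (cinner (J x) (J y)) = Re (cnj (cinner x y))"
    by (simp add: Re)
  show "Im (cinner (J x) (J y)) = Im (cnj (cinner x y))"
    using Re[of x "\<i> *\<^sub>C y"] by (simp add: antilinear_scaleC[OF assms] cinner_scaleC_right)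
qed

lemma antilinear_isometry_inv:
  assumes "antilinear_isometry J" "surj J"
  shows "antilinear_isometry (inv J)"
proof -
  have J: "J (inv J x) = x" for x
    by (rule surj_f_inv_f[OF assms(2)])
  note inj = antilinear_inj[OF assms(1), THEN injD]
  show ?thesis
    unfolding antilinear_isometry_def
  proof (intro conjI allI)
    show "inv J (x + y) = inv J x + inv J y" for x y
      by (rule inj) (simp add: J antilinear_add[OF assms(1)])
    show "inv J (c *\<^sub>C x) = cnj c *\<^sub>C inv J x" for c x
      by (rule inj) (simp add: J antilinear_scaleC[OF assms(1)])
    show "norm (inv J x) = norm x" for x
      using antilinear_norm[OF assms(1), of "inv J x"] by (simp add: J)
  qed
qed

text \<open>\<open>opposite\<close> without the adjoint. On adjoint-closed sets both have the same
  image, but this one preserves the order of composition.\<close>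

definition conj_op :: "('h \<Rightarrow> 'h) \<Rightarrow> ('h \<Rightarrow> 'h) \<Rightarrow> 'h::complex_hilbert \<Rightarrow> 'h" where
  "conj_op J T = J \<circ> T \<circ> inv J"

lemma opposite_eq_conj_op: "opposite J T = conj_op J (cadjoint T)"
  by (simp add: opposite_def conj_op_def)

lemma conj_op_apply: "conj_op J T x = J (T (inv J x))"
  by (simp add: conj_op_def)

lemma bounded_clinear_conj_op:
  assumes J: "antilinear_isometry J" "surj J" and T: "bounded_clinear T"
  shows "bounded_clinear (conj_op J T)"
proof -
  note J' = antilinear_isometry_inv[OF J]
  have "bounded_linear (\<lambda>x. J (T (inv J x)))"
    by (intro bounded_linear_compose[OF antilinear_bounded_linear[OF J(1)]]
        bounded_linear_compose[OF bounded_clinearD(1)[OF T]] antilinear_bounded_linear J')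
  then show ?thesis
    by (simp add: bounded_clinear_def conj_op_def comp_def bounded_clinearD[OF T]
        antilinear_scaleC[OF J(1)] antilinear_scaleC[OF J'])
qed

lemma cadjoint_conj_op:
  assumes J: "antilinear_isometry J" "surj J" and T: "bounded_clinear T"
  shows "cadjoint (conj_op J T) = conj_op J (cadjoint T)"
proof (rule cadjoint_eqI)
  note JJ = surj_f_inv_f[OF J(2)]
  show "bounded_clinear (conj_op J (cadjoint T))"
    by (intro bounded_clinear_conj_op J bounded_clinear_cadjoint T)
  show "cinner (conj_op J T x) y = cinner x (conj_op J (cadjoint T) y)" for x y
    using antilinear_cinner[OF J(1), of "T (inv J x)" "inv J y"]
      antilinear_cinner[OF J(1), of "inv J x" "cadjoint T (inv J y)"]
    by (simp add: conj_op_apply JJ cinner_cadjoint[OF T])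
qed

text \<open>Conjugating the relation by \<open>inv J\<close> moves the conjugation from
  \<open>S\<close> to \<open>T\<close>, which makes \<open>S\<close> accessible to a commutant
  argument.\<close>

lemma conj_op_commute_iff:
  assumes "inj J" "surj J"
  shows "(\<forall>x. conj_op J S (T x) = T (conj_op J S x))
    \<longleftrightarrow> (\<forall>x. S (conj_op (inv J) T x) = conj_op (inv J) T (S x))" (is "?L \<longleftrightarrow> ?R")
proof -
  have inv: "inv (inv J) = J"
    using assms by (simp add: inv_inv_eq bij_def)
  note J = surj_f_inv_f[OF assms(2)] inv_f_f[OF assms(1)]
  show ?thesis
  proof
    assume ?L
    then have "conj_op J S (T (J x)) = T (conj_op J S (J x))" for x by blast
    then have "inv J (conj_op J S (T (J x))) = inv J (T (conj_op J S (J x)))" for x by simp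
    then show ?R
      by (simp add: conj_op_apply inv J)
  next
    assume ?R
    then have "S (conj_op (inv J) T (inv J x)) = conj_op (inv J) T (S (inv J x))" for x by blast
    then have "J (S (conj_op (inv J) T (inv J x))) = J (conj_op (inv J) T (S (inv J x)))" for x
      by simp
    then show ?L
      by (simp add: conj_op_apply inv J)
  qed
qed

text \<open>Two passes, one per argument. The \<open>T\<close> that commute with the conjugates of
  \<open>G\<close> form a commutant containing \<open>G\<close>, hence the generated algebra. Then
  \<open>conj_op_commute_iff\<close> describes the admissible \<open>S\<close> as the commutant of
  the conjugates of the whole generated algebra under \<open>inv J\<close>, and the same reasoning
  applies.\<close>

lemma conj_op_commute_generated:
  assumes J: "antilinear_isometry J" "surj J"
    and bounded: "\<And>T. T \<in> G \<Longrightarrow> bounded_clinear T" and adj: "\<And>T. T \<in> G \<Longrightarrow> cadjoint T \<in> G"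
    and comm: "\<And>S T x. S \<in> G \<Longrightarrow> T \<in> G \<Longrightarrow> conj_op J S (T x) = T (conj_op J S x)"
    and ST: "S \<in> cstar_generated G" "T \<in> cstar_generated G"
  shows "conj_op J S (T x) = T (conj_op J S x)"
proof -
  let ?C = "cstar_generated G"
  note inj = antilinear_inj[OF J(1)]
  have bij: "bij J" using inj J(2) by (simp add: bij_def)
  note J' = antilinear_isometry_inv[OF J] bij_imp_bij_inv[OF bij, THEN bij_is_surj]
  have C: "bounded_clinear T" if "T \<in> ?C" for T
    using bounded that by (rule cstar_generated_bounded_clinear)
  have "?C \<subseteq> commutant (conj_op J ` G)"
  proof (rule cstar_generated_minimal)
    show "cstar_subalgebra (commutant (conj_op J ` G))"
    proof (rule cstar_subalgebra_commutant)
      fix R assume "R \<in> conj_op J ` G"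
      then obtain S where S: "R = conj_op J S" "S \<in> G" by blast
      show "bounded_clinear R"
        unfolding S(1) by (rule bounded_clinear_conj_op[OF J bounded[OF S(2)]])
      show "cadjoint R \<in> conj_op J ` G"
        unfolding S(1) cadjoint_conj_op[OF J bounded[OF S(2)]]
        by (rule imageI[OF adj[OF S(2)]])
    qed
    show "G \<subseteq> commutant (conj_op J ` G)"
    proof (rule subsetI, rule commutantI)
      fix T R x assume "T \<in> G" "R \<in> conj_op J ` G"
      then show "T (R x) = R (T x)" by (auto simp: comm)
    qed (rule bounded)
  qed
  then have 1: "conj_op J S (T x) = T (conj_op J S x)" if "S \<in> G" "T \<in> ?C" for S T x
    using commutantD(2)[OF subsetD[OF _ that(2)] imageI[OF that(1)]] by metis
  have "?C \<subseteq> commutant (conj_op (inv J) ` ?C)"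
  proof (rule cstar_generated_minimal)
    show "cstar_subalgebra (commutant (conj_op (inv J) ` ?C))"
    proof (rule cstar_subalgebra_commutant)
      fix R assume "R \<in> conj_op (inv J) ` ?C"
      then obtain S where S: "R = conj_op (inv J) S" "S \<in> ?C" by blast
      show "bounded_clinear R"
        unfolding S(1) by (rule bounded_clinear_conj_op[OF J' C[OF S(2)]])
      show "cadjoint R \<in> conj_op (inv J) ` ?C"
        unfolding S(1) cadjoint_conj_op[OF J' C[OF S(2)]]
        by (rule imageI[OF cadjoint_in_cstar_generated[OF S(2)]])
    qed
    show "G \<subseteq> commutant (conj_op (inv J) ` ?C)"
    proof (rule subsetI, rule commutantI)
      fix S R x assume S: "S \<in> G" and "R \<in> conj_op (inv J) ` ?C"
      then obtain T where T: "R = conj_op (inv J) T" "T \<in> ?C" by blast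
      show "S (R x) = R (S x)"
        using conj_op_commute_iff[OF inj J(2), of S T] 1[OF S T(2)] unfolding T(1) by blast
    qed (rule bounded)
  qed
  from commutantD(2)[OF subsetD[OF this ST(1)] imageI[OF ST(2)]]
  show ?thesis
    using conj_op_commute_iff[OF inj J(2), of S T] by blast
qed


section \<open>Graded spaces\<close>

text \<open>The degree is an arbitrary natural number of which only the parity matters, so degrees
  can be added and multiplied without reduction modulo 2.\<close>

definition has_parity :: "('h::complex_hilbert \<Rightarrow> 'h) \<Rightarrow> nat \<Rightarrow> ('h \<Rightarrow> 'h) \<Rightarrow> bool" where
  "has_parity g p T \<longleftrightarrow> (\<forall>x. g (T x) = (-1) ^ p *\<^sub>R T (g x))"

lemma has_parityD: "has_parity g p T \<Longrightarrow> g (T x) = (-1) ^ p *\<^sub>R T (g x)"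
  by (simp add: has_parity_def)

text \<open>What an even triple with a real structure, twisted or not, says about the grading and
  \<open>J\<close> alone.\<close>

locale graded_real =
  fixes g :: "'h::complex_hilbert \<Rightarrow> 'h" and J :: "'h \<Rightarrow> 'h" and \<epsilon> \<epsilon>'' :: real
  assumes g: "bounded_clinear g" and g_adj: "cadjoint g = g" and gg: "g (g x) = x"
    and J: "antilinear_isometry J"
    and sign: "\<epsilon> \<in> {1, -1}" and sign'': "\<epsilon>'' \<in> {1, -1}"
    and JJ: "J (J x) = \<epsilon> *\<^sub>R x" and Jg: "J (g x) = \<epsilon>'' *\<^sub>R g (J x)"
begin

lemma sign_sq [simp]: "\<epsilon> * \<epsilon> = 1" "\<epsilon>'' * \<epsilon>'' = 1"
  using sign sign'' by auto

text \<open>An isometry need not be onto; here the square being a sign supplies a preimage.\<close>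

lemma surj_J: "surj J"
proof (rule surjI)
  show "J (\<epsilon> *\<^sub>R J y) = y" for y
    by (simp add: antilinear_scaleR[OF J] JJ)
qed

lemmas J_inv = surj_f_inv_f[OF surj_J]
lemmas inv_J = inv_f_f[OF antilinear_inj[OF J]]
lemmas invJ = antilinear_isometry_inv[OF J surj_J]

lemma inv_Jg: "inv J (g x) = \<epsilon>'' *\<^sub>R g (inv J x)"
proof -
  have "J (g (inv J x)) = \<epsilon>'' *\<^sub>R g x"
    by (simp add: Jg J_inv)
  then have "g (inv J x) = \<epsilon>'' *\<^sub>R inv J (g x)"
    by (metis inv_J antilinear_scaleR[OF invJ])
  then show ?thesis by simp
qed

lemma bounded_clinear_gpow: "bounded_clinear (g ^^ n)"
  by (induction n) (simp_all only: funpow.simps bounded_clinear_id bounded_clinear_comp[OF g])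

lemma cadjoint_gpow: "cadjoint (g ^^ n) = g ^^ n"
proof (induction n)
  case 0
  show ?case by (intro cadjoint_eqI) auto
next
  case (Suc n)
  have "cadjoint (g ^^ Suc n) = cadjoint (g ^^ n) \<circ> cadjoint g"
    by (simp add: cadjoint_comp g bounded_clinear_gpow)
  then show ?case
    by (simp only: Suc g_adj funpow_Suc_right)
qed

lemma gpow_parity: "has_parity g p T \<Longrightarrow> (g ^^ n) (T x) = (-1) ^ (p * n) *\<^sub>R T ((g ^^ n) x)"
  by (induction n) (simp_all add: has_parity_def bounded_clinearD[OF g] power_add mult.commute)

lemma gpow_homogeneous: "g v = (-1) ^ p *\<^sub>R v \<Longrightarrow> (g ^^ n) v = (-1) ^ (p * n) *\<^sub>R v"
  by (induction n) (simp_all add: bounded_clinearD[OF g] power_add mult.commute)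

lemma J_gpow: "J ((g ^^ n) x) = \<epsilon>'' ^ n *\<^sub>R (g ^^ n) (J x)"
  by (induction n) (simp_all add: bounded_clinearD[OF g] Jg mult.commute)

text \<open>The grading picks up \<epsilon>'' once when passing \<open>J\<close> and once when
  passing \<open>inv J\<close>, and the two factors cancel.\<close>

lemma has_parity_conj_op:
  assumes "has_parity g p T" "bounded_clinear T"
  shows "has_parity g p (conj_op J T)"
  unfolding has_parity_def
proof
  fix x
  have "g (J y) = \<epsilon>'' *\<^sub>R J (g y)" for y
    by (simp add: Jg)
  then show "g (conj_op J T x) = (- 1) ^ p *\<^sub>R conj_op J T (g x)"
    by (simp add: conj_op_apply inv_Jg has_parityD[OF assms(1)] antilinear_scaleR[OF J]
        bounded_clinearD[OF assms(2)] mult.commute)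
qed

lemma has_parity_cadjoint:
  assumes T: "has_parity g p T" "bounded_clinear T"
  shows "has_parity g p (cadjoint T)"
  unfolding has_parity_def
proof (intro allI cinner_ext)
  fix x y
  have gadj: "cinner u (g v) = cinner (g u) v" for u v
    using cinner_cadjoint[OF g] by (simp add: g_adj)
  have "T (g y) = (-1) ^ p *\<^sub>R g (T y)"
    using has_parityD[OF T(1), of y] by (simp add: power_mult_distrib[symmetric])
  then show "cinner y (g (cadjoint T x)) = cinner y ((- 1) ^ p *\<^sub>R cadjoint T (g x))"
    by (simp add: gadj cinner_cadjoint[OF T(2)] cinner_scaleR_right cinner_scaleR_left)
qed

lemma homogeneous_decomposition:
  obtains v0 v1 where "v = v0 + v1" "g v0 = (-1) ^ 0 *\<^sub>R v0" "g v1 = (-1) ^ 1 *\<^sub>R v1"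
proof
  show "v = (1 / 2) *\<^sub>R (v + g v) + (1 / 2) *\<^sub>R (v - g v)"
    by (simp add: scaleR_add_right[symmetric] scaleR_2[symmetric])
qed (simp_all add: bounded_clinearD[OF g] gg add.commute scaleR_diff_right)

end


section \<open>The product real structure\<close>

locale graded_real_product = hilbert_tensor_product t +
  L: graded_real g1 J1 \<epsilon>1 \<epsilon>1'' + R: graded_real g2 J2 \<epsilon>2 \<epsilon>2''
  for t :: "'a::complex_hilbert \<Rightarrow> 'b::complex_hilbert \<Rightarrow> 'c::complex_hilbert"
    and g1 J1 :: "'a \<Rightarrow> 'a" and \<epsilon>1 \<epsilon>1'' and g2 J2 :: "'b \<Rightarrow> 'b" and \<epsilon>2 \<epsilon>2''
begin

text \<open>Each leg is a sum of an even and an odd vector. This matches the definition of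
  \<open>J\<close>, whose values are prescribed only on homogeneous tensors.\<close>

lemma tensor_ext_homogeneous:
  fixes F F' :: "'c \<Rightarrow> 'd::real_normed_vector"
  assumes F: "bounded_linear F" "bounded_linear F'"
    and eq: "\<And>p q v w. p \<in> {0, 1::nat} \<Longrightarrow> q \<in> {0, 1::nat} \<Longrightarrow>
      g1 v = (-1) ^ p *\<^sub>R v \<Longrightarrow> g2 w = (-1) ^ q *\<^sub>R w \<Longrightarrow> F (t v w) = F' (t v w)"
  shows "F = F'"
proof (rule tensor_ext[OF F])
  fix v w
  obtain v0 v1 where v: "v = v0 + v1" "g1 v0 = (-1) ^ 0 *\<^sub>R v0" "g1 v1 = (-1) ^ 1 *\<^sub>R v1"
    by (rule L.homogeneous_decomposition)
  obtain w0 w1 where w: "w = w0 + w1" "g2 w0 = (-1) ^ 0 *\<^sub>R w0" "g2 w1 = (-1) ^ 1 *\<^sub>R w1"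
    by (rule R.homogeneous_decomposition)
  interpret F: bounded_linear F by fact
  interpret F': bounded_linear F' by fact
  show "F (t v w) = F' (t v w)"
    using eq[OF _ _ v(2) w(2)] eq[OF _ _ v(2) w(3)] eq[OF _ _ v(3) w(2)] eq[OF _ _ v(3) w(3)]
    by (simp add: v(1) w(1) t_add_left t_add_right F.add F'.add)
qed

text \<open>\<open>koszul\<close> is multiplication by the Koszul sign \<open>(-1)^(|v| |w|)\<close>.\<close>

definition koszul :: "'c \<Rightarrow> 'c" where
  "koszul x = (1 / 2) *\<^sub>R
     (x + op_tensor t g1 id x + (op_tensor t id g2 x - op_tensor t g1 g2 x))"

lemmas bounded_clinear_gg =
  bounded_clinear_op_tensor[OF L.g bounded_clinear_id(1)]
  bounded_clinear_op_tensor[OF bounded_clinear_id(1) R.g]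
  bounded_clinear_op_tensor[OF L.g R.g]

lemma bounded_clinear_koszul: "bounded_clinear koszul"
proof -
  have "bounded_linear koszul"
    unfolding koszul_def[abs_def]
    by (intro bounded_linear_const_scaleR bounded_linear_add bounded_linear_sub bounded_linear_ident
        bounded_clinearD(1)[OF bounded_clinear_gg(1)] bounded_clinearD(1)[OF bounded_clinear_gg(2)]
        bounded_clinearD(1)[OF bounded_clinear_gg(3)])
  then show ?thesis
    by (simp add: bounded_clinear_def koszul_def bounded_clinearD[OF bounded_clinear_gg(1)]
        bounded_clinearD[OF bounded_clinear_gg(2)] bounded_clinearD[OF bounded_clinear_gg(3)]
        scaleR_scaleC scaleC_scaleC scaleC_add_right scaleC_diff_right mult.commute)
qed

lemma koszul_t:
  "koszul (t v w) = (1 / 2) *\<^sub>R (t v w + t (g1 v) w + (t v (g2 w) - t (g1 v) (g2 w)))"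
  by (simp add: koszul_def op_tensor_apply L.g R.g)

text \<open>For signs \<open>a\<close> and \<open>b\<close> the expression
  \<open>(1 + a + b - a * b) / 2\<close> is -1 when both are -1, and 1 otherwise.\<close>

lemma koszul_homogeneous:
  assumes "g1 v = (-1) ^ p *\<^sub>R v" "g2 w = (-1) ^ q *\<^sub>R w"
  shows "koszul (t v w) = (-1) ^ (p * q) *\<^sub>R t v w"
  unfolding koszul_t assms
  by (cases "even p"; cases "even q")
    (simp_all add: t_scaleR_left t_scaleR_right bt.minus_left bt.minus_right
      scaleR_2[symmetric] scaleR_half_double[of "- t v w", simplified])

lemma koszul_koszul: "koszul (koszul x) = x"
proof -
  have "(\<lambda>x. koszul (koszul x)) = (\<lambda>x. x)"
  proof (rule tensor_ext_homogeneous)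
    show "bounded_linear (\<lambda>x. koszul (koszul x))"
      using bounded_clinear_koszul by (intro bounded_linear_compose[OF bounded_clinearD(1) bounded_clinearD(1)])
    show "koszul (koszul (t v w)) = t v w"
      if "g1 v = (-1) ^ p *\<^sub>R v" "g2 w = (-1) ^ q *\<^sub>R w" for p q v w
      using koszul_homogeneous[OF that]
      by (simp add: bounded_clinearD[OF bounded_clinear_koszul] power_mult_distrib[symmetric])
  qed simp
  then show ?thesis by (rule fun_cong)
qed

text \<open>Together with \<open>koszul_koszul\<close> this makes \<open>koszul\<close> a
  self-adjoint involution, hence unitary.\<close>

lemma koszul_symmetric: "cinner (koszul x) y = cinner x (koszul y)"
proof -
  have "cinner (op_tensor t g1 id x) y = cinner x (op_tensor t g1 id y)"
    "cinner (op_tensor t id g2 x) y = cinner x (op_tensor t id g2 y)"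
    "cinner (op_tensor t g1 g2 x) y = cinner x (op_tensor t g1 g2 y)"
    using cinner_cadjoint[OF bounded_clinear_gg(1)] cinner_cadjoint[OF bounded_clinear_gg(2)]
      cinner_cadjoint[OF bounded_clinear_gg(3)]
    by (simp_all add: cadjoint_op_tensor L.g R.g L.g_adj R.g_adj cadjoint_id)
  then show ?thesis
    by (simp add: koszul_def cinner_scaleR_left cinner_scaleR_right cinner_add_left
        cinner_add_right cinner_diff_left cinner_diff_right)
qed

lemma norm_koszul: "norm (koszul x) = norm x"
proof -
  have "(norm (koszul x))\<^sup>2 = (norm x)\<^sup>2"
    by (simp add: power2_norm_eq_cinner koszul_symmetric koszul_koszul)
  then show ?thesis
    by (simp add: power2_eq_iff_nonneg)
qed

text \<open>A single lift suffices here, because \<open>J2\<close> preserves orthogonality of the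
  second legs. The lift is real linear with bound 1; the identity of
  \<open>cinner (U x) (U y)\<close> with \<open>cnj (cinner x y)\<close>, checked on simple tensors
  in one slot and then in the other, makes it isometric.\<close>

lemma antilinear_tensor_exists:
  "\<exists>U. antilinear_isometry U \<and> (\<forall>v w. U (t v w) = t (J1 v) (J2 w))"
proof -
  have "\<exists>U. bounded_linear U \<and> (\<forall>v w. U (t v w) = t (J1 v) (J2 w))"
  proof (rule tensor_lift[of _ 1])
    show "cinner (t (J1 v) (J2 w)) (t (J1 v') (J2 w')) = 0" if "cinner w w' = 0" for v w v' w'
      using that by (simp add: cinner_t antilinear_cinner[OF L.J] antilinear_cinner[OF R.J])
  qed (simp_all add: antilinear_add[OF L.J] antilinear_add[OF R.J] antilinear_scaleR[OF L.J]
      antilinear_scaleC[OF L.J] antilinear_scaleC[OF R.J] antilinear_norm[OF L.J]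
      antilinear_norm[OF R.J] t_add_left t_add_right t_scaleR_left t_scaleC_left t_scaleC_right
      norm_t)
  then obtain U where U: "bounded_linear U" "\<And>v w. U (t v w) = t (J1 v) (J2 w)"
    by blast
  note left = bounded_bilinear.bounded_linear_left[OF bounded_bilinear_cinner]
  note right = bounded_bilinear.bounded_linear_right[OF bounded_bilinear_cinner]
  note cnj = bounded_linear_compose[OF bounded_linear_cnj]
  have "(\<lambda>x. cinner (U x) (t (J1 v') (J2 w'))) = (\<lambda>x. cnj (cinner x (t v' w')))" for v' w'
  proof (rule tensor_ext)
    show "bounded_linear (\<lambda>x. cinner (U x) (t (J1 v') (J2 w')))"
      by (rule bounded_linear_compose[OF left U(1)])
    show "bounded_linear (\<lambda>x. cnj (cinner x (t v' w')))"
      by (rule cnj[OF left])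
    show "cinner (U (t v w)) (t (J1 v') (J2 w')) = cnj (cinner (t v w) (t v' w'))" for v w
      by (simp add: U cinner_t antilinear_cinner[OF L.J] antilinear_cinner[OF R.J])
  qed
  then have 1: "cinner (U x) (t (J1 v') (J2 w')) = cnj (cinner x (t v' w'))" for x v' w'
    by (rule fun_cong)
  have "(\<lambda>y. cinner (U x) (U y)) = (\<lambda>y. cnj (cinner x y))" for x
  proof (rule tensor_ext)
    show "bounded_linear (\<lambda>y. cinner (U x) (U y))"
      by (rule bounded_linear_compose[OF right U(1)])
    show "bounded_linear (\<lambda>y. cnj (cinner x y))"
      by (rule cnj[OF right])
  qed (simp add: U 1)
  then have "cinner (U x) (U y) = cnj (cinner x y)" for x y
    by (rule fun_cong)
  then have "(norm (U x))\<^sup>2 = (norm x)\<^sup>2" for x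
    by (simp add: power2_norm_eq_cinner)
  then have norm: "norm (U x) = norm x" for x
    by (simp add: power2_eq_iff_nonneg)
  have "(\<lambda>x. U (c *\<^sub>C x)) = (\<lambda>x. cnj c *\<^sub>C U x)" for c
  proof (rule tensor_ext)
    show "bounded_linear (\<lambda>x. U (c *\<^sub>C x))"
      by (rule bounded_linear_compose[OF U(1) bounded_linear_scaleC])
    show "bounded_linear (\<lambda>x. cnj c *\<^sub>C U x)"
      by (rule bounded_linear_compose[OF bounded_linear_scaleC U(1)])
  qed (simp add: t_scaleC_left[symmetric] U antilinear_scaleC[OF L.J])
  then have "U (c *\<^sub>C x) = cnj c *\<^sub>C U x" for c x
    by (rule fun_cong)
  then have "antilinear_isometry U"
    using norm by (simp add: antilinear_isometry_def linear_simps[OF U(1)])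
  with U(2) show ?thesis by blast
qed

text \<open>The property that characterises \<open>product_J\<close>, stated for all natural
  degrees. The sign depends only on parities, so this is no stronger than degrees 0 and 1, and sums
  of degrees can be inserted directly.\<close>

definition is_product_J :: "('c \<Rightarrow> 'c) \<Rightarrow> bool" where
  "is_product_J J \<longleftrightarrow> antilinear_isometry J \<and>
     (\<forall>p q v w. g1 v = (-1) ^ p *\<^sub>R v \<longrightarrow> g2 w = (-1) ^ q *\<^sub>R w \<longrightarrow>
        J (t v w) = (-1) ^ (p * q) *\<^sub>R t (J1 v) (J2 w))"

text \<open>Applying \<open>koszul\<close> before \<open>J1\<close> tensor \<open>J2\<close> inserts
  the sign. As \<open>koszul\<close> is an involution and \<open>U\<close> squares to the sign
  \<epsilon>1 times \<epsilon>2, preimages are explicit.\<close>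

lemma product_J_exists: "\<exists>J. is_product_J J \<and> surj J"
proof -
  obtain U where U: "antilinear_isometry U" "\<And>v w. U (t v w) = t (J1 v) (J2 w)"
    using antilinear_tensor_exists by blast
  note bl = antilinear_bounded_linear[OF U(1)]
  have "(\<lambda>x. U (U x)) = (\<lambda>x. (\<epsilon>1 * \<epsilon>2) *\<^sub>R x)"
    by (rule tensor_ext)
      (simp_all add: bounded_linear_compose[OF bl bl] U L.JJ R.JJ t_scaleR_left t_scaleR_right
        bounded_linear_scaleR_right)
  then have UU: "U (U x) = (\<epsilon>1 * \<epsilon>2) *\<^sub>R x" for x
    by (rule fun_cong)
  let ?J = "\<lambda>x. U (koszul x)"
  have "antilinear_isometry ?J"
    by (simp add: antilinear_isometry_def bounded_clinearD[OF bounded_clinear_koszul]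
        antilinear_add[OF U(1)] antilinear_scaleC[OF U(1)] antilinear_norm[OF U(1)] norm_koszul)
  then have "is_product_J ?J"
    unfolding is_product_J_def
  proof (intro conjI allI impI)
    fix p q v w assume "g1 v = (-1) ^ p *\<^sub>R v" "g2 w = (-1) ^ q *\<^sub>R w"
    from koszul_homogeneous[OF this] show "?J (t v w) = (-1) ^ (p * q) *\<^sub>R t (J1 v) (J2 w)"
      by (simp add: antilinear_scaleR[OF U(1)] U(2))
  qed
  moreover have "surj ?J"
  proof (rule surjI)
    show "?J (koszul ((\<epsilon>1 * \<epsilon>2) *\<^sub>R U y)) = y" for y
      using L.sign R.sign by (auto simp: koszul_koszul antilinear_scaleR[OF U(1)] UU)
  qed
  ultimately show ?thesis by blast
qed

lemma antilinear_homogeneous_ext: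
  assumes "antilinear_isometry J" "antilinear_isometry J'"
    and "\<And>p q v w. p \<in> {0, 1::nat} \<Longrightarrow> q \<in> {0, 1::nat} \<Longrightarrow>
      g1 v = (-1) ^ p *\<^sub>R v \<Longrightarrow> g2 w = (-1) ^ q *\<^sub>R w \<Longrightarrow> J (t v w) = J' (t v w)"
  shows "J = J'"
  using assms by (intro tensor_ext_homogeneous antilinear_bounded_linear)

text \<open>Up to sign conventions, the homogeneous elements of the graded tensor product of
  \<open>C1\<close> and \<open>C2\<close> in their usual representation. Note that \<open>q\<close>
  is both the exponent of \<open>g1\<close> and the degree of \<open>y\<close>.\<close>

definition generators :: "('a \<Rightarrow> 'a) set \<Rightarrow> ('b \<Rightarrow> 'b) set \<Rightarrow> ('c \<Rightarrow> 'c) set" where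
  "generators C1 C2 = {op_tensor t ((g1 ^^ q) \<circ> x) y | p q x y.
     x \<in> C1 \<and> has_parity g1 p x \<and> y \<in> C2 \<and> has_parity g2 q y}"

lemma generatorsI:
  "x \<in> C1 \<Longrightarrow> has_parity g1 p x \<Longrightarrow> y \<in> C2 \<Longrightarrow> has_parity g2 q y \<Longrightarrow>
    op_tensor t ((g1 ^^ q) \<circ> x) y \<in> generators C1 C2"
  unfolding generators_def by blast

lemma generatorsE:
  assumes "T \<in> generators C1 C2"
  obtains p q x y where "T = op_tensor t ((g1 ^^ q) \<circ> x) y"
    "x \<in> C1" "has_parity g1 p x" "y \<in> C2" "has_parity g2 q y"
  using assms unfolding generators_def by blast

lemma bounded_clinear_generator:
  assumes "\<And>x. x \<in> C1 \<Longrightarrow> bounded_clinear x" "\<And>y. y \<in> C2 \<Longrightarrow> bounded_clinear y"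
    and "T \<in> generators C1 C2"
  shows "bounded_clinear T"
  using assms(3)
  by (rule generatorsE)
    (simp only: bounded_clinear_op_tensor bounded_clinear_comp L.bounded_clinear_gpow assms(1,2))

text \<open>Taking adjoints puts the power of \<open>g1\<close> behind \<open>cadjoint x\<close>.
  Bringing it back to the front costs a sign, which \<open>x'\<close> absorbs.\<close>

lemma cadjoint_generator:
  assumes C1: "star_subalgebra C1" and C2: "star_subalgebra C2" and T: "T \<in> generators C1 C2"
  shows "cadjoint T \<in> generators C1 C2"
  using T
proof (rule generatorsE)
  fix p q x y
  assume T: "T = op_tensor t ((g1 ^^ q) \<circ> x) y"
    and x: "x \<in> C1" "has_parity g1 p x" and y: "y \<in> C2" "has_parity g2 q y"
  note bdd_x = star_subalgebraD(1)[OF C1 x(1)] and bdd_y = star_subalgebraD(1)[OF C2 y(1)]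
  define x' where "x' = (\<lambda>v. (-1) ^ (p * q) *\<^sub>R cadjoint x v)"
  have p: "has_parity g1 p (cadjoint x)"
    by (rule L.has_parity_cadjoint[OF x(2) bdd_x])
  then have x': "has_parity g1 p x'"
    by (simp add: has_parity_def x'_def bounded_clinearD[OF L.g] mult.commute)
  have "cadjoint x \<circ> (g1 ^^ q) = (g1 ^^ q) \<circ> x'"
    by (simp add: fun_eq_iff x'_def bounded_clinearD[OF L.bounded_clinear_gpow]
        L.gpow_parity[OF p] power_mult_distrib[symmetric])
  then have "cadjoint T = op_tensor t ((g1 ^^ q) \<circ> x') (cadjoint y)"
    unfolding T
    by (simp add: cadjoint_op_tensor bounded_clinear_comp L.bounded_clinear_gpow bdd_x bdd_y
        cadjoint_comp L.cadjoint_gpow)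
  moreover have "x' \<in> C1"
    unfolding x'_def scaleR_scaleC by (intro star_subalgebraD(4,6)[OF C1] x(1))
  ultimately show ?thesis
    using generatorsI[OF _ x' star_subalgebraD(6)[OF C2 y(1)] R.has_parity_cadjoint[OF y(2) bdd_y]]
    by simp
qed

text \<open>Checked in the form "\<open>J\<close> after \<open>A\<close> equals a sign times
  \<open>B\<close> after \<open>J\<close>" on homogeneous tensors, where \<open>J\<close> is known
  explicitly; \<open>inv J\<close> is composed only at the end.\<close>

lemma conj_op_generator:
  assumes J: "is_product_J J" "surj J"
    and x: "bounded_clinear x" "has_parity g1 p x" and y: "bounded_clinear y" "has_parity g2 q y"
  shows "conj_op J (op_tensor t ((g1 ^^ q) \<circ> x) y) =
    (\<lambda>z. \<epsilon>2'' ^ p *\<^sub>R op_tensor t (conj_op J1 x) (conj_op J2 y \<circ> (g2 ^^ p)) z)"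
proof -
  have J': "antilinear_isometry J"
    and Jt: "\<And>p q v w. g1 v = (-1) ^ p *\<^sub>R v \<Longrightarrow> g2 w = (-1) ^ q *\<^sub>R w \<Longrightarrow>
        J (t v w) = (-1) ^ (p * q) *\<^sub>R t (J1 v) (J2 w)"
    using J(1) by (simp_all add: is_product_J_def)
  define A where "A = op_tensor t ((g1 ^^ q) \<circ> x) y"
  define B where "B = op_tensor t (conj_op J1 x) (conj_op J2 y \<circ> (g2 ^^ p))"
  have A: "bounded_clinear A" "A (t v w) = t ((g1 ^^ q) (x v)) (y w)" for v w
    unfolding A_def
    by (simp_all add: bounded_clinear_op_tensor op_tensor_apply bounded_clinear_comp x y
        L.bounded_clinear_gpow)
  have B: "bounded_clinear B" "B (t v w) = t (conj_op J1 x v) (conj_op J2 y ((g2 ^^ p) w))" for v w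
    unfolding B_def
    by (simp_all add: bounded_clinear_op_tensor op_tensor_apply bounded_clinear_comp x y
        R.bounded_clinear_gpow bounded_clinear_conj_op L.J L.surj_J R.J R.surj_J)
  have "(\<lambda>z. J (A z)) = (\<lambda>z. \<epsilon>2'' ^ p *\<^sub>R B (J z))"
  proof (rule tensor_ext_homogeneous)
    show "bounded_linear (\<lambda>z. J (A z))"
      by (rule bounded_linear_compose[OF antilinear_bounded_linear[OF J'] bounded_clinearD(1)[OF A(1)]])
    show "bounded_linear (\<lambda>z. \<epsilon>2'' ^ p *\<^sub>R B (J z))"
      by (rule bounded_linear_const_scaleR[OF bounded_linear_compose[OF bounded_clinearD(1)[OF B(1)]
              antilinear_bounded_linear[OF J']]])
    fix a b :: nat and v w
    assume v: "g1 v = (-1) ^ a *\<^sub>R v" and w: "g2 w = (-1) ^ b *\<^sub>R w"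
    have xv: "g1 (x v) = (-1) ^ (a + p) *\<^sub>R x v"
      by (simp add: has_parityD[OF x(2)] v bounded_clinearD[OF x(1)] power_add mult.commute)
    have yw: "g2 (y w) = (-1) ^ (b + q) *\<^sub>R y w"
      by (simp add: has_parityD[OF y(2)] w bounded_clinearD[OF y(1)] power_add mult.commute)
    have "J (A (t v w)) = ((-1) ^ ((a + p) * q) * (-1) ^ ((a + p) * (b + q))) *\<^sub>R t (J1 (x v)) (J2 (y w))"
      unfolding A(2) L.gpow_homogeneous[OF xv]
      by (simp add: t_scaleR_left antilinear_scaleR[OF J'] Jt[OF xv yw])
    \<comment> \<open>The power of \<open>g1\<close> contributes \<open>(a + p) * q\<close>, the
      Koszul sign \<open>(a + p) * (b + q)\<close>; the terms with \<open>q\<close> occur twice and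
      cancel. Of what remains, \<open>a * b\<close> is the sign of \<open>J\<close> on
      \<open>t v w\<close>, and \<open>p * b\<close> is the action of
      \<open>g2 ^^ p\<close>.\<close>
    also have "(-1) ^ ((a + p) * q) * (-1) ^ ((a + p) * (b + q)) = ((-1) ^ ((a + p) * b) :: real)"
      by (cases "even (a + p)"; cases "even b"; cases "even q")
        (simp_all only: even_mult_iff even_add power_minus_even power_minus_odd
          power_one mult_1 mult_minus_left mult_minus_right minus_minus mult_1_right
          even_plus_one_iff simp_thms)
    finally have 1: "J (A (t v w)) = (-1) ^ ((a + p) * b) *\<^sub>R t (J1 (x v)) (J2 (y w))" .
    \<comment> \<open>Each exchange of \<open>g2\<close> with \<open>J2\<close> costs \<epsilon>2''.
      This is the origin of the scalar in the statement, which squares to 1 and cancels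
      here.\<close>
    have "(g2 ^^ p) (J2 w) = \<epsilon>2'' ^ p *\<^sub>R (-1) ^ (b * p) *\<^sub>R J2 w"
    proof -
      have "(g2 ^^ p) (J2 w) = \<epsilon>2'' ^ p *\<^sub>R J2 ((g2 ^^ p) w)"
        by (simp add: R.J_gpow power_mult_distrib[symmetric])
      then show ?thesis
        by (simp add: R.gpow_homogeneous[OF w] antilinear_scaleR[OF R.J])
    qed
    then have "conj_op J2 y ((g2 ^^ p) (J2 w)) = \<epsilon>2'' ^ p *\<^sub>R (-1) ^ (b * p) *\<^sub>R J2 (y w)"
      using bounded_clinearD(7)[OF bounded_clinear_conj_op[OF R.J R.surj_J y(1)]]
      by (simp add: conj_op_apply R.inv_J)
    then have "\<epsilon>2'' ^ p *\<^sub>R B (J (t v w)) = (-1) ^ (a * b) *\<^sub>R (-1) ^ (b * p) *\<^sub>R t (J1 (x v)) (J2 (y w))"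
      by (simp add: Jt[OF v w] bounded_clinearD[OF B(1)] B(2) conj_op_apply[of J1] L.inv_J
          t_scaleR_right power_mult_distrib[symmetric] mult.left_commute[of "\<epsilon>2'' ^ p"]
          mult.assoc[symmetric])
    also have "\<dots> = J (A (t v w))"
      unfolding 1 by (simp add: distrib_right power_add mult.commute[of p b])
    finally show "J (A (t v w)) = \<epsilon>2'' ^ p *\<^sub>R B (J (t v w))" ..
  qed
  then have "J (A (inv J z)) = \<epsilon>2'' ^ p *\<^sub>R B (J (inv J z))" for z
    by (rule fun_cong)
  then show ?thesis
    unfolding A_def[symmetric] B_def[symmetric]
    by (simp add: fun_eq_iff conj_op_apply surj_f_inv_f[OF J(2)])
qed

lemma conj_op_generator_commute:
  assumes J: "is_product_J J" "surj J"
    and C1: "\<And>x. x \<in> C1 \<Longrightarrow> bounded_clinear x" and C2: "\<And>y. y \<in> C2 \<Longrightarrow> bounded_clinear y"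
    and comm1: "\<And>x x' v. x \<in> C1 \<Longrightarrow> x' \<in> C1 \<Longrightarrow> conj_op J1 x (x' v) = x' (conj_op J1 x v)"
    and comm2: "\<And>y y' w. y \<in> C2 \<Longrightarrow> y' \<in> C2 \<Longrightarrow> conj_op J2 y (y' w) = y' (conj_op J2 y w)"
    and S: "S \<in> generators C1 C2" and T: "T \<in> generators C1 C2"
  shows "conj_op J S (T z) = T (conj_op J S z)"
proof -
  obtain p q x y where S: "S = op_tensor t ((g1 ^^ q) \<circ> x) y"
    and x: "x \<in> C1" "has_parity g1 p x" and y: "y \<in> C2" "has_parity g2 q y"
    using S by (rule generatorsE)
  obtain r s a b where T: "T = op_tensor t ((g1 ^^ s) \<circ> a) b"
    and a: "a \<in> C1" "has_parity g1 r a" and b: "b \<in> C2" "has_parity g2 s b"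
    using T by (rule generatorsE)
  define B where "B = op_tensor t (conj_op J1 x) (conj_op J2 y \<circ> (g2 ^^ p))"
  note bdd_x = bounded_clinear_conj_op[OF L.J L.surj_J C1[OF x(1)]]
  note bdd_y = bounded_clinear_conj_op[OF R.J R.surj_J C2[OF y(1)]]
  have B: "bounded_clinear B" "B (t v w) = t (conj_op J1 x v) (conj_op J2 y ((g2 ^^ p) w))" for v w
    unfolding B_def
    by (simp_all add: bounded_clinear_op_tensor op_tensor_apply bounded_clinear_comp bdd_x bdd_y
        R.bounded_clinear_gpow)
  have T': "bounded_clinear T" "T (t v w) = t ((g1 ^^ s) (a v)) (b w)" for v w
    unfolding T
    by (simp_all add: bounded_clinear_op_tensor op_tensor_apply bounded_clinear_comp C1 C2 a b
        L.bounded_clinear_gpow)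
  have px: "has_parity g1 p (conj_op J1 x)"
    by (rule L.has_parity_conj_op[OF x(2) C1[OF x(1)]])
  \<comment> \<open>The conjugate of \<open>S\<close> is a real multiple of \<open>B\<close>, and
    \<open>T\<close> is linear, so commutation of \<open>T\<close> with \<open>B\<close> is
    enough.\<close>
  have "(\<lambda>z. B (T z)) = (\<lambda>z. T (B z))"
  proof (rule tensor_ext)
    show "bounded_linear (\<lambda>z. B (T z))" "bounded_linear (\<lambda>z. T (B z))"
      by (intro bounded_linear_compose[OF bounded_clinearD(1) bounded_clinearD(1)] B(1) T'(1))+
    fix v w
    have "conj_op J1 x ((g1 ^^ s) (a v)) = (-1) ^ (p * s) *\<^sub>R (g1 ^^ s) (a (conj_op J1 x v))"
      using L.gpow_parity[OF px, of s "a v"]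
      by (simp add: comm1[OF x(1) a(1), symmetric] power_mult_distrib[symmetric])
    moreover have "conj_op J2 y ((g2 ^^ p) (b w)) = (-1) ^ (s * p) *\<^sub>R b (conj_op J2 y ((g2 ^^ p) w))"
      by (simp add: R.gpow_parity[OF b(2)] bounded_clinearD[OF bdd_y] comm2[OF y(1) b(1)])
    ultimately show "B (T (t v w)) = T (B (t v w))"
      by (simp add: B T' t_scaleR_left t_scaleR_right mult.commute[of s p]
          power_mult_distrib[symmetric])
  qed
  then have "B (T z) = T (B z)"
    by (rule fun_cong)
  then show ?thesis
    unfolding S conj_op_generator[OF J C1[OF x(1)] x(2) C2[OF y(1)] y(2)] B_def[symmetric]
    by (simp add: bounded_clinearD[OF T'(1)])
qed

end


section \<open>Spectral triples\<close>

lemma opval_eqI: "single_valued D \<Longrightarrow> (x, y) \<in> D \<Longrightarrow> opval D x = y"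
  unfolding opval_def by (rule the_equality) (auto dest: single_valuedD)

lemma opval_graph: "single_valued D \<Longrightarrow> x \<in> Domain D \<Longrightarrow> (x, opval D x) \<in> D"
  using opval_eqI by fastforce

text \<open>Uniqueness is left as a premise because density is supplied differently: directly by the
  dense domain of a factor, and through tensors of domain vectors for the product.\<close>

lemma bcommutator_eqI:
  assumes "extends_commutator D a T"
    and "\<And>T'. bounded_linear T' \<Longrightarrow> (\<And>x. x \<in> Domain D \<Longrightarrow> T' x = T x) \<Longrightarrow> T' = T"
  shows "bcommutator D a = T"
  unfolding bcommutator_def
proof (rule the_equality)
  fix T' assume T': "extends_commutator D a T'"
  show "T' = T"
    by (rule assms(2)) (use T' assms(1) in \<open>auto simp: extends_commutator_def bounded_clinear_def\<close>)
qed fact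

lemma
  assumes "even_spectral_triple X"
  shows even_star: "star_subalgebra (alg X)"
    and even_single_valued: "single_valued (dirac X)"
    and even_dense: "closure (Domain (dirac X)) = UNIV"
    and even_grading: "bounded_clinear (grading X)" "cadjoint (grading X) = grading X"
      "grading X (grading X x) = x"
    and even_alg: "a \<in> alg X \<Longrightarrow> grading X (a x) = a (grading X x)"
    and even_dirac: "x \<in> Domain (dirac X) \<Longrightarrow> grading X x \<in> Domain (dirac X)"
      "x \<in> Domain (dirac X) \<Longrightarrow>
        opval (dirac X) (grading X x) = - grading X (opval (dirac X) x)"
  using assms
  unfolding even_spectral_triple_def spectral_triple_def self_adjoint_def linear_operator_def
  by (simp_all add: fun_eq_iff)

lemma even_dirac_graph:
  "even_spectral_triple X \<Longrightarrow> x \<in> Domain (dirac X) \<Longrightarrow> (x, opval (dirac X) x) \<in> dirac X"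
  by (rule opval_graph[OF even_single_valued])

lemma even_dirac_scaleC:
  assumes "even_spectral_triple X" "x \<in> Domain (dirac X)"
  shows "c *\<^sub>C x \<in> Domain (dirac X)"
    and "opval (dirac X) (c *\<^sub>C x) = c *\<^sub>C opval (dirac X) x"
proof -
  have "linear_operator (dirac X)"
    using assms(1)
    unfolding even_spectral_triple_def spectral_triple_def self_adjoint_def by simp
  then have "(c *\<^sub>C x, c *\<^sub>C opval (dirac X) x) \<in> dirac X"
    using even_dirac_graph[OF assms] unfolding linear_operator_def by simp
  then show "c *\<^sub>C x \<in> Domain (dirac X)"
    and "opval (dirac X) (c *\<^sub>C x) = c *\<^sub>C opval (dirac X) x"
    using opval_eqI[OF even_single_valued[OF assms(1)]] by auto
qed

lemma even_dirac_symmetric: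
  assumes "even_spectral_triple X" "x \<in> Domain (dirac X)" "y \<in> Domain (dirac X)"
  shows "cinner (opval (dirac X) x) y = cinner x (opval (dirac X) y)"
proof -
  have "adjoint_graph (dirac X) = dirac X"
    using assms(1)
    unfolding even_spectral_triple_def spectral_triple_def self_adjoint_def by simp
  then have "(y, opval (dirac X) y) \<in> adjoint_graph (dirac X)"
    using even_dirac_graph[OF assms(1,3)] by simp
  then show ?thesis
    using even_dirac_graph[OF assms(1,2)] unfolding adjoint_graph_def by auto
qed

lemma even_bcommutator:
  assumes X: "even_spectral_triple X" and a: "a \<in> alg X"
  shows "extends_commutator (dirac X) a (bcommutator (dirac X) a)"
proof -
  obtain T where T: "extends_commutator (dirac X) a T"
    using X a unfolding even_spectral_triple_def spectral_triple_def by blast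
  have "bcommutator (dirac X) a = T"
  proof (rule bcommutator_eqI[OF T])
    fix T' assume "bounded_linear T'" "\<And>x. x \<in> Domain (dirac X) \<Longrightarrow> T' x = T x"
    then show "T' = T"
      using T by (intro bounded_linear_dense_ext[OF _ _ even_dense[OF X]])
        (auto simp: extends_commutator_def bounded_clinear_def)
  qed
  with T show ?thesis by simp
qed

lemma
  assumes "even_spectral_triple X" "a \<in> alg X"
  shows even_bcommutator_bounded: "bounded_clinear (bcommutator (dirac X) a)"
    and even_alg_domain: "x \<in> Domain (dirac X) \<Longrightarrow> a x \<in> Domain (dirac X)"
    and even_bcommutator_apply: "x \<in> Domain (dirac X) \<Longrightarrow>
      bcommutator (dirac X) a x = opval (dirac X) (a x) - a (opval (dirac X) x)"
  using even_bcommutator[OF assms] unfolding extends_commutator_def by simp_all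

lemma has_parity_alg: "even_spectral_triple X \<Longrightarrow> a \<in> alg X \<Longrightarrow> has_parity (grading X) 0 a"
  by (simp add: has_parity_def even_alg)

text \<open>On the domain, the grading commutes with \<open>a\<close> and anticommutes with the
  Dirac operator; density extends the resulting sign to all vectors.\<close>

lemma has_parity_bcommutator:
  assumes X: "even_spectral_triple X" and a: "a \<in> alg X"
  shows "has_parity (grading X) 1 (bcommutator (dirac X) a)"
proof -
  let ?g = "grading X" and ?T = "bcommutator (dirac X) a"
  note g = bounded_clinearD[OF even_grading(1)[OF X]]
  note T = bounded_clinearD[OF even_bcommutator_bounded[OF X a]]
  note A = bounded_clinearD[OF star_subalgebraD(1)[OF even_star[OF X] a]]
  have "(\<lambda>x. ?g (?T x)) = (\<lambda>x. - ?T (?g x))"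
  proof (rule bounded_linear_dense_ext[OF _ _ even_dense[OF X]])
    show "bounded_linear (\<lambda>x. ?g (?T x))"
      by (rule bounded_linear_compose[OF g(1) T(1)])
    show "bounded_linear (\<lambda>x. - ?T (?g x))"
      by (rule bounded_linear_minus[OF bounded_linear_compose[OF T(1) g(1)]])
    show "?g (?T x) = - ?T (?g x)" if x: "x \<in> Domain (dirac X)" for x
      using even_dirac(2)[OF X even_alg_domain[OF X a x]]
      by (simp add: even_bcommutator_apply[OF X a] x even_dirac[OF X x] g A
          even_alg[OF X a, symmetric])
  qed
  then have "?g (?T x) = - ?T (?g x)" for x
    by (rule fun_cong)
  then show ?thesis
    by (simp add: has_parity_def)
qed

section \<open>The Clifford algebra of a single triple\<close>

lemma clifford_generator_bounded:
  assumes X: "even_spectral_triple X" and T: "T \<in> alg X \<union> one_forms X"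
  shows "bounded_clinear T"
proof -
  have "{a \<circ> bcommutator (dirac X) b | a b. a \<in> alg X \<and> b \<in> alg X} \<subseteq> {T. bounded_clinear T}"
    using bounded_clinear_comp[OF star_subalgebraD(1)[OF even_star[OF X]] even_bcommutator_bounded[OF X]]
    by auto
  then have "one_forms X \<subseteq> {T. bounded_clinear T}"
    unfolding one_forms_def by (rule op_span_subset[OF star_subalgebra_bounded])
  then show ?thesis
    using T star_subalgebraD(1)[OF even_star[OF X]] by auto
qed

lemma star_subalgebra_clifford:
  "even_spectral_triple X \<Longrightarrow> star_subalgebra (clifford X)"
  unfolding clifford_def
  by (rule star_subalgebra_cstar_generated) (rule clifford_generator_bounded)

lemma alg_clifford: "alg X \<subseteq> clifford X"
  unfolding clifford_def using cstar_generated_superset[of "alg X \<union> one_forms X"] by blast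

text \<open>The algebra is unital, so a commutator is itself a one-form, with coefficient
  \<open>id\<close>.\<close>

lemma bcommutator_clifford:
  assumes X: "even_spectral_triple X" and a: "a \<in> alg X"
  shows "bcommutator (dirac X) a \<in> clifford X"
proof -
  have "id \<in> alg X"
    using X unfolding even_spectral_triple_def spectral_triple_def by simp
  then have "id \<circ> bcommutator (dirac X) a \<in> one_forms X"
    unfolding one_forms_def using a by (intro subsetD[OF op_span_superset]) blast
  then show ?thesis
    unfolding clifford_def using cstar_generated_superset[of "alg X \<union> one_forms X"] by auto
qed

text \<open>The condition is applied to \<open>cadjoint S\<close>, so that the adjoint inside
  \<open>opposite\<close> gives back \<open>S\<close>.\<close>

lemma second_order_commute:
  assumes X: "even_spectral_triple X" and J: "second_order_condition X J"
    and S: "S \<in> clifford X" and T: "T \<in> clifford X"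
  shows "conj_op J S (T x) = T (conj_op J S x)"
proof -
  note C = star_subalgebra_clifford[OF X]
  have "opposite J (cadjoint S) \<in> commutant (clifford X)"
    using J star_subalgebraD(6)[OF C S] unfolding second_order_condition_def by blast
  then have "conj_op J S \<in> commutant (clifford X)"
    by (simp add: opposite_eq_conj_op cadjoint_cadjoint star_subalgebraD(1)[OF C S])
  from commutantD(2)[OF this T] show ?thesis .
qed


section \<open>The product Dirac operator\<close>

lemma span_linear_image:
  assumes "linear f" "f ` S \<subseteq> span S" "p \<in> span S"
  shows "f p \<in> span S"
proof -
  have "f p \<in> span (f ` S)"
    using assms(3) by (simp add: linear_span_image[OF assms(1)])
  then show ?thesis
    using span_minimal[OF assms(2) subspace_span] by blast
qed

locale product_triples =
  graded_real_product t "grading X1" J1 \<epsilon>1 \<epsilon>1'' "grading X2" J2 \<epsilon>2 \<epsilon>2''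
  for t :: "'a::complex_hilbert \<Rightarrow> 'b::complex_hilbert \<Rightarrow> 'c::complex_hilbert"
    and X1 :: "'a even_triple" and J1 \<epsilon>1 \<epsilon>1'' and X2 :: "'b even_triple" and J2 \<epsilon>2 \<epsilon>2'' +
  assumes X1: "even_spectral_triple X1" and X2: "even_spectral_triple X2"
begin

abbreviation "g1 \<equiv> grading X1"
abbreviation "D1 \<equiv> opval (dirac X1)"
abbreviation "D2 \<equiv> opval (dirac X2)"
abbreviation "D \<equiv> product_dirac t (dirac X1) g1 (dirac X2)"

text \<open>Generates the graph of the uncompleted product operator by real linear combinations, so
  that linear and continuous maps of pairs can be checked on simple tensors.\<close>

definition simple_graph :: "('c \<times> 'c) set" where
  "simple_graph = {(t v w, t (D1 v) w + t (g1 v) (D2 w)) | v w.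
     v \<in> Domain (dirac X1) \<and> w \<in> Domain (dirac X2)}"

lemma simple_graphI:
  "v \<in> Domain (dirac X1) \<Longrightarrow> w \<in> Domain (dirac X2) \<Longrightarrow>
    (t v w, t (D1 v) w + t (g1 v) (D2 w)) \<in> simple_graph"
  unfolding simple_graph_def by blast

lemma D_eq_closure_span: "D = closure (span simple_graph)"
proof -
  let ?core = "{(\<Sum>i<n. t (v i) (w i), \<Sum>i<n. t (D1 (v i)) (w i) + t (g1 (v i)) (D2 (w i)))
      | (n::nat) v w. \<forall>i<n. v i \<in> Domain (dirac X1) \<and> w i \<in> Domain (dirac X2)}"
  have "?core = span simple_graph"
  proof (intro equalityI subsetI)
    fix p assume "p \<in> ?core"
    then obtain n :: nat and v w where
      p: "p = (\<Sum>i<n. t (v i) (w i), \<Sum>i<n. t (D1 (v i)) (w i) + t (g1 (v i)) (D2 (w i)))"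
      and vw: "\<forall>i<n. v i \<in> Domain (dirac X1) \<and> w i \<in> Domain (dirac X2)"
      unfolding mem_Collect_eq by (elim exE conjE) (rule that; assumption)
    have "(\<Sum>i<m. t (v i) (w i), \<Sum>i<m. t (D1 (v i)) (w i) + t (g1 (v i)) (D2 (w i)))
        \<in> span simple_graph" if "m \<le> n" for m
      using that
    proof (induction m)
      case 0
      show ?case by (simp add: zero_prod_def[symmetric] span_zero)
    next
      case (Suc m)
      then have "(t (v m) (w m), t (D1 (v m)) (w m) + t (g1 (v m)) (D2 (w m))) \<in> span simple_graph"
        using vw by (intro span_base simple_graphI) auto
      from span_add[OF Suc.IH this] Suc.prems show ?case by simp
    qed
    then show "p \<in> span simple_graph"
      unfolding p by simp
  next
    fix p assume "p \<in> span simple_graph"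
    then show "p \<in> ?core"
    proof (induction rule: span_induct_alt)
      case base
      show ?case by (intro CollectI exI[of _ 0]) (auto simp: zero_prod_def)
    next
      case (step r x y)
      obtain v w where x: "x = (t v w, t (D1 v) w + t (g1 v) (D2 w))"
        and v: "v \<in> Domain (dirac X1)" and w: "w \<in> Domain (dirac X2)"
        using step(1) unfolding simple_graph_def by blast
      obtain n :: nat and v' w' where
        y: "y = (\<Sum>i<n. t (v' i) (w' i), \<Sum>i<n. t (D1 (v' i)) (w' i) + t (g1 (v' i)) (D2 (w' i)))"
        and vw: "\<forall>i<n. v' i \<in> Domain (dirac X1) \<and> w' i \<in> Domain (dirac X2)"
        using step(2) unfolding mem_Collect_eq by (elim exE conjE) (rule that; assumption)
      have rv: "r *\<^sub>R v \<in> Domain (dirac X1)" "D1 (r *\<^sub>R v) = r *\<^sub>R D1 v"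
        using even_dirac_scaleC[OF X1 v] by (simp_all add: scaleR_scaleC)
      have "r *\<^sub>R x + y =
        (\<Sum>i<Suc n. t ((v'(n := r *\<^sub>R v)) i) ((w'(n := w)) i),
         \<Sum>i<Suc n. t (D1 ((v'(n := r *\<^sub>R v)) i)) ((w'(n := w)) i)
           + t (g1 ((v'(n := r *\<^sub>R v)) i)) (D2 ((w'(n := w)) i)))"
        by (simp add: x y rv t_scaleR_left bounded_clinearD[OF L.g] scaleR_add_right)
      moreover have "\<forall>i<Suc n. (v'(n := r *\<^sub>R v)) i \<in> Domain (dirac X1)
          \<and> (w'(n := w)) i \<in> Domain (dirac X2)"
        using vw rv(1) w by (simp add: less_Suc_eq)
      ultimately show ?case
        by blast
    qed
  qed
  then show ?thesis
    by (simp add: product_dirac_def)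
qed

lemma simple_graph_D: "simple_graph \<subseteq> D"
  unfolding D_eq_closure_span using span_superset closure_subset by blast

text \<open>The product operator is symmetric on simple tensors; hence its closure is again the graph of
  an operator.\<close>

lemma single_valued_D: "single_valued D"
proof (rule single_valuedI)
  fix x y y' assume "(x, y) \<in> D" "(x, y') \<in> D"
  have sym: "cinner (t (D1 v) w + t (g1 v) (D2 w)) x = cinner (t v w) y"
    if "(x, y) \<in> D" "v \<in> Domain (dirac X1)" "w \<in> Domain (dirac X2)" for x y v w
  proof -
    let ?u = "t (D1 v) w + t (g1 v) (D2 w)"
    let ?E = "{p. cinner ?u (fst p) = cinner (t v w) (snd p)}"
    have "simple_graph \<subseteq> ?E"
    proof
      fix p assume "p \<in> simple_graph"
      then obtain v' w' where p: "p = (t v' w', t (D1 v') w' + t (g1 v') (D2 w'))"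
        and v': "v' \<in> Domain (dirac X1)" and w': "w' \<in> Domain (dirac X2)"
        unfolding simple_graph_def by blast
      show "p \<in> ?E"
        using cinner_cadjoint[OF L.g, of v v'] even_dirac_symmetric[OF X1 that(2) v']
          even_dirac_symmetric[OF X2 that(3) w']
        by (simp add: p cinner_add_left cinner_add_right cinner_t L.g_adj)
    qed
    moreover have "subspace ?E"
      by (simp add: subspace_def cinner_add_right cinner_scaleR_right)
    ultimately have "span simple_graph \<subseteq> ?E"
      by (rule span_minimal)
    moreover have "closed ?E"
      by (intro closed_Collect_eq continuous_intros)
    ultimately have "D \<subseteq> ?E"
      unfolding D_eq_closure_span by (rule closure_minimal)
    with that(1) show ?thesis by auto
  qed
  have "(\<lambda>u. cinner u y) = (\<lambda>u. cinner u y')"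
  proof (rule tensor_dense_ext[OF _ _ even_dense[OF X1] even_dense[OF X2]])
    show "cinner (t v w) y = cinner (t v w) y'"
      if "v \<in> Domain (dirac X1)" "w \<in> Domain (dirac X2)" for v w
      using sym[OF \<open>(x, y) \<in> D\<close> that] sym[OF \<open>(x, y') \<in> D\<close> that] by simp
  qed (rule bounded_bilinear.bounded_linear_left[OF bounded_bilinear_cinner])+
  then have "cinner u y = cinner u y'" for u
    by (rule fun_cong)
  then show "y = y'"
    by (rule cinner_ext)
qed

text \<open>The premise \<open>core\<close> says in terms of graphs that \<open>b\<close> preserves
  the core and has commutator \<open>T\<close> there. The map sending \<open>(x, y)\<close> to
  \<open>(b x, T x + b y)\<close> is continuous, hence preserves the closure \<open>D\<close> as
  well.\<close>

lemma D_bcommutator_eqI: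
  assumes b: "bounded_clinear b" and T: "bounded_clinear T"
    and core: "\<And>x y. (x, y) \<in> span simple_graph \<Longrightarrow> (b x, T x + b y) \<in> span simple_graph"
  shows "bcommutator D b = T"
proof (rule bcommutator_eqI)
  note blb = bounded_clinearD(1)[OF b] and blT = bounded_clinearD(1)[OF T]
  have D: "(b x, T x + b y) \<in> D" if "(x, y) \<in> D" for x y
  proof -
    let ?f = "\<lambda>p. (b (fst p), T (fst p) + b (snd p))"
    have "?f ` closure (span simple_graph) \<subseteq> closure (span simple_graph)"
    proof (rule image_closure_subset)
      show "continuous_on (closure (span simple_graph)) ?f"
        by (intro continuous_intros bounded_linear.continuous_on[OF blb]
            bounded_linear.continuous_on[OF blT])
      show "?f ` span simple_graph \<subseteq> closure (span simple_graph)"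
        using core closure_subset by fastforce
    qed simp
    then show ?thesis
      using that unfolding D_eq_closure_span by (auto dest!: subsetD)
  qed
  show "extends_commutator D b T"
    unfolding extends_commutator_def
  proof (intro conjI ballI T)
    fix x assume "x \<in> Domain D"
    then obtain y where xy: "(x, y) \<in> D" by blast
    show "b x \<in> Domain D"
      using D[OF xy] by blast
    show "T x = opval D (b x) - b (opval D x)"
      using opval_eqI[OF single_valued_D xy] opval_eqI[OF single_valued_D D[OF xy]] by simp
  qed
  fix T' assume T': "bounded_linear T'" "\<And>x. x \<in> Domain D \<Longrightarrow> T' x = T x"
  show "T' = T"
  proof (rule tensor_dense_ext[OF T'(1) blT even_dense[OF X1] even_dense[OF X2]])
    show "T' (t v w) = T (t v w)"
      if "v \<in> Domain (dirac X1)" "w \<in> Domain (dirac X2)" for v w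
      using simple_graphI[OF that] simple_graph_D by (intro T'(2)) blast
  qed
qed

text \<open>The span is taken over the reals; a complex scalar is absorbed by the first leg, whose
  Dirac domain is a complex subspace.\<close>

lemma span_simple_graph_scaleC:
  assumes "(x, y) \<in> span simple_graph"
  shows "(c *\<^sub>C x, c *\<^sub>C y) \<in> span simple_graph"
proof -
  let ?f = "\<lambda>p. (c *\<^sub>C fst p, c *\<^sub>C snd p) :: 'c \<times> 'c"
  have "?f (x, y) \<in> span simple_graph"
  proof (rule span_linear_image[OF _ _ assms])
    show "linear ?f"
      by (rule linearI) (simp_all add: scaleC_add_right scaleR_scaleC scaleC_scaleC mult.commute)
    show "?f ` simple_graph \<subseteq> span simple_graph"
    proof (rule image_subsetI)
      fix p assume "p \<in> simple_graph"
      then obtain v w where p: "p = (t v w, t (D1 v) w + t (g1 v) (D2 w))"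
        and v: "v \<in> Domain (dirac X1)" and w: "w \<in> Domain (dirac X2)"
        unfolding simple_graph_def by blast
      have "?f p = (t (c *\<^sub>C v) w, t (D1 (c *\<^sub>C v)) w + t (g1 (c *\<^sub>C v)) (D2 w))"
        by (simp add: p even_dirac_scaleC[OF X1 v] t_scaleC_left scaleC_add_right
            bounded_clinearD[OF L.g])
      then show "?f p \<in> span simple_graph"
        using span_base[OF simple_graphI[OF even_dirac_scaleC(1)[OF X1 v] w]] by simp
    qed
  qed
  then show ?thesis by simp
qed

lemma span_simple_graph_op_tensor:
  assumes b1: "b1 \<in> alg X1" and b2: "b2 \<in> alg X2" and xy: "(x, y) \<in> span simple_graph"
  defines "b \<equiv> op_tensor t b1 b2"
    and "T \<equiv> \<lambda>x. op_tensor t (bcommutator (dirac X1) b1) b2 x +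
      op_tensor t (g1 \<circ> b1) (bcommutator (dirac X2) b2) x"
  shows "(b x, T x + b y) \<in> span simple_graph"
proof -
  note b1' = star_subalgebraD(1)[OF even_star[OF X1] b1]
  note b2' = star_subalgebraD(1)[OF even_star[OF X2] b2]
  note gb1 = bounded_clinear_comp[OF L.g b1']
  note d1 = even_bcommutator_bounded[OF X1 b1] and d2 = even_bcommutator_bounded[OF X2 b2]
  have b: "bounded_clinear b"
    unfolding b_def by (rule bounded_clinear_op_tensor[OF b1' b2'])
  have T: "bounded_clinear T"
    unfolding T_def
    by (rule bounded_clinear_add[OF bounded_clinear_op_tensor[OF d1 b2']
          bounded_clinear_op_tensor[OF gb1 d2]])
  let ?f = "\<lambda>p. (b (fst p), T (fst p) + b (snd p))"
  have "?f (x, y) \<in> span simple_graph"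
  proof (rule span_linear_image[OF _ _ xy])
    show "linear ?f"
      by (rule linearI) (simp_all add: bounded_clinearD[OF b] bounded_clinearD[OF T] scaleR_add_right)
    show "?f ` simple_graph \<subseteq> span simple_graph"
    proof (rule image_subsetI)
      fix p assume "p \<in> simple_graph"
      then obtain v w where p: "p = (t v w, t (D1 v) w + t (g1 v) (D2 w))"
        and v: "v \<in> Domain (dirac X1)" and w: "w \<in> Domain (dirac X2)"
        unfolding simple_graph_def by blast
      have b_t: "b (t v w) = t (b1 v) (b2 w)" for v w
        unfolding b_def by (rule op_tensor_apply[OF b1' b2'])
      have "T (t v w) = t (D1 (b1 v) - b1 (D1 v)) (b2 w)
          + t (g1 (b1 v)) (D2 (b2 w) - b2 (D2 w))"
        by (simp add: T_def op_tensor_apply d1 d2 b2' gb1 even_bcommutator_apply[OF X1 b1 v]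
            even_bcommutator_apply[OF X2 b2 w])
      \<comment> \<open>The subtracted terms cancel against \<open>b (snd p)\<close>. For the second
        one this uses that \<open>b1\<close> commutes with the grading \<open>g1\<close>.\<close>
      then have "?f p = (t (b1 v) (b2 w), t (D1 (b1 v)) (b2 w) + t (g1 (b1 v)) (D2 (b2 w)))"
        by (simp add: p b_t bounded_clinearD[OF b] even_alg[OF X1 b1] bt.diff_left bt.diff_right)
      then show "?f p \<in> span simple_graph"
        using span_base[OF simple_graphI[OF even_alg_domain[OF X1 b1 v] even_alg_domain[OF X2 b2 w]]]
        by simp
    qed
  qed
  then show ?thesis by simp
qed


section \<open>The Clifford algebra of the product\<close>

abbreviation "G \<equiv> generators (clifford X1) (clifford X2)"

lemma op_tensor_alg_generator:
  assumes "b1 \<in> alg X1" "b2 \<in> alg X2"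
  shows "op_tensor t b1 b2 \<in> G"
  using generatorsI[OF subsetD[OF alg_clifford assms(1)] has_parity_alg[OF X1 assms(1)]
      subsetD[OF alg_clifford assms(2)] has_parity_alg[OF X2 assms(2)]]
  by simp

lemma product_alg_subset:
  assumes "star_subalgebra B" "G \<subseteq> B"
  shows "product_alg t (alg X1) (alg X2) \<subseteq> B"
  unfolding product_alg_def
  by (rule op_span_subset[OF assms(1)]) (use op_tensor_alg_generator assms(2) in blast)

text \<open>The induction runs on the graph property rather than on \<open>bcommutator\<close>: that
  property is additive in the pair of \<open>b\<close> and \<open>T\<close>, while the description
  operator is evaluated once, for the complete sum.\<close>

lemma product_bcommutator_in:
  assumes B: "star_subalgebra B" and G: "G \<subseteq> B" and b: "b \<in> product_alg t (alg X1) (alg X2)"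
  shows "bcommutator D b \<in> B"
proof -
  have "\<exists>T\<in>B. \<forall>x y. (x, y) \<in> span simple_graph \<longrightarrow> (b x, T x + b y) \<in> span simple_graph"
    using b unfolding product_alg_def
  proof (induction rule: op_span_induct)
    case zero
    show ?case
      by (rule bexI[OF _ star_subalgebraD(2)[OF B]]) (simp add: zero_prod_def[symmetric] span_zero)
  next
    case (step R c b)
    then obtain b1 b2 where R: "R = op_tensor t b1 b2" and b1: "b1 \<in> alg X1" and b2: "b2 \<in> alg X2"
      by blast
    obtain T where T: "T \<in> B"
      "\<And>x y. (x, y) \<in> span simple_graph \<Longrightarrow> (b x, T x + b y) \<in> span simple_graph"
      using step.IH by blast
    define S where "S = (\<lambda>x. op_tensor t (bcommutator (dirac X1) b1) b2 x +
      op_tensor t (g1 \<circ> b1) (bcommutator (dirac X2) b2) x)"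
    \<comment> \<open>Degrees \<open>p = 1\<close> and \<open>q = 0\<close>, so no grading appears;
      the next term has \<open>p = 0\<close> and \<open>q = 1\<close>, which accounts for its
      \<open>g1\<close>.\<close>
    have "op_tensor t (bcommutator (dirac X1) b1) b2 \<in> G"
      using generatorsI[OF bcommutator_clifford[OF X1 b1] has_parity_bcommutator[OF X1 b1]
          subsetD[OF alg_clifford b2] has_parity_alg[OF X2 b2]] by simp
    moreover have "op_tensor t (g1 \<circ> b1) (bcommutator (dirac X2) b2) \<in> G"
      using generatorsI[OF subsetD[OF alg_clifford b1] has_parity_alg[OF X1 b1]
          bcommutator_clifford[OF X2 b2] has_parity_bcommutator[OF X2 b2]] by simp
    ultimately have "S \<in> B"
      unfolding S_def using G by (intro star_subalgebraD(3)[OF B]) blast+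
    show ?case
    proof (rule bexI)
      show "(\<lambda>x. T x + c *\<^sub>C S x) \<in> B"
        by (rule star_subalgebraD(3)[OF B T(1) star_subalgebraD(4)[OF B \<open>S \<in> B\<close>]])
      show "\<forall>x y. (x, y) \<in> span simple_graph \<longrightarrow>
          (b x + c *\<^sub>C R x, T x + c *\<^sub>C S x + (b y + c *\<^sub>C R y)) \<in> span simple_graph"
      proof (intro allI impI)
        fix x y assume xy: "(x, y) \<in> span simple_graph"
        have "(R x, S x + R y) \<in> span simple_graph"
          unfolding R S_def by (rule span_simple_graph_op_tensor[OF b1 b2 xy])
        from span_add[OF T(2)[OF xy] span_simple_graph_scaleC[OF this, of c]]
        show "(b x + c *\<^sub>C R x, T x + c *\<^sub>C S x + (b y + c *\<^sub>C R y)) \<in> span simple_graph"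
          by (simp add: scaleC_add_right add_ac)
      qed
    qed
  qed
  then obtain T where T: "T \<in> B"
    "\<And>x y. (x, y) \<in> span simple_graph \<Longrightarrow> (b x, T x + b y) \<in> span simple_graph"
    by blast
  have "bcommutator D b = T"
    using star_subalgebraD(1)[OF B] product_alg_subset[OF B G] b T by (intro D_bcommutator_eqI) auto
  with T(1) show ?thesis by simp
qed

text \<open>An inclusion is enough, because commutation relations restrict to smaller
  algebras.\<close>

lemma product_clifford_subset: "clifford (product_triple t X1 X2) \<subseteq> cstar_generated G"
  unfolding clifford_def[of "product_triple t X1 X2"]
proof (rule cstar_generated_subset)
  fix B assume B: "star_subalgebra B" "G \<subseteq> B"
  let ?A = "product_alg t (alg X1) (alg X2)"
  note A = product_alg_subset[OF B]
  have "a \<circ> bcommutator D b \<in> B" if "a \<in> ?A" "b \<in> ?A" for a b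
    by (rule star_subalgebraD(5)[OF B(1) subsetD[OF A that(1)] product_bcommutator_in[OF B that(2)]])
  then have "one_forms (product_triple t X1 X2) \<subseteq> B"
    unfolding one_forms_def by (intro op_span_subset[OF B(1)]) (auto simp: product_triple_def)
  with A show "alg (product_triple t X1 X2) \<union> one_forms (product_triple t X1 X2) \<subseteq> B"
    by (simp add: product_triple_def)
qed

lemma product_J_eqI:
  assumes "is_product_J J"
  shows "product_J t X1 X2 J1 J2 = J"
  unfolding product_J_def
proof (rule the_equality)
  note J = assms[unfolded is_product_J_def]
  show *: "antilinear_isometry J \<and> (\<forall>p q v w. homogeneous X1 p v \<longrightarrow> homogeneous X2 q w \<longrightarrow>
      J (t v w) = (-1) ^ (p * q) *\<^sub>R t (J1 v) (J2 w))"
    using J unfolding homogeneous_def by blast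
  fix J' assume J': "antilinear_isometry J' \<and> (\<forall>p q v w. homogeneous X1 p v \<longrightarrow> homogeneous X2 q w \<longrightarrow>
      J' (t v w) = (-1) ^ (p * q) *\<^sub>R t (J1 v) (J2 w))"
  show "J' = J"
  proof (rule antilinear_homogeneous_ext)
    fix p q :: nat and v w
    assume "p \<in> {0, 1}" "q \<in> {0, 1}" "g1 v = (-1) ^ p *\<^sub>R v" "grading X2 w = (-1) ^ q *\<^sub>R w"
    then have "homogeneous X1 p v" "homogeneous X2 q w"
      unfolding homogeneous_def by blast+
    then show "J' (t v w) = J (t v w)"
      using * J' by simp
  qed (use J J' in blast)+
qed

theorem second_order_product:
  assumes "second_order_condition X1 J1" "second_order_condition X2 J2"
  shows "second_order_condition (product_triple t X1 X2) (product_J t X1 X2 J1 J2)"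
proof -
  obtain J where J: "is_product_J J" "surj J"
    using product_J_exists by blast
  then have J': "antilinear_isometry J"
    by (simp add: is_product_J_def)
  note C1 = star_subalgebra_clifford[OF X1] and C2 = star_subalgebra_clifford[OF X2]
  have G: "bounded_clinear T" if "T \<in> G" for T
    using star_subalgebraD(1)[OF C1] star_subalgebraD(1)[OF C2] that
    by (rule bounded_clinear_generator)
  have comm: "conj_op J S (T x) = T (conj_op J S x)"
    if "S \<in> cstar_generated G" "T \<in> cstar_generated G" for S T x
  proof (rule conj_op_commute_generated[OF J' J(2) _ _ _ that])
    show "bounded_clinear T" "cadjoint T \<in> G" if "T \<in> G" for T
      using G[OF that] cadjoint_generator[OF C1 C2 that] .
    show "conj_op J S (T x) = T (conj_op J S x)" if "S \<in> G" "T \<in> G" for S T x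
      using J star_subalgebraD(1)[OF C1] star_subalgebraD(1)[OF C2]
        second_order_commute[OF X1 assms(1)] second_order_commute[OF X2 assms(2)] that
      by (rule conj_op_generator_commute)
  qed
  show ?thesis
    unfolding second_order_condition_def product_J_eqI[OF J(1)]
  proof (rule image_subsetI, rule commutantI)
    fix S assume "S \<in> clifford (product_triple t X1 X2)"
    \<comment> \<open>\<open>opposite J S\<close> is the conjugate of \<open>cadjoint S\<close>, so
      the adjoint is what enters \<open>comm\<close>.\<close>
    then have S: "cadjoint S \<in> cstar_generated G"
      by (intro cadjoint_in_cstar_generated subsetD[OF product_clifford_subset])
    show "bounded_clinear (opposite J S)"
      unfolding opposite_eq_conj_op
      by (rule bounded_clinear_conj_op[OF J' J(2) cstar_generated_bounded_clinear[OF G S]])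
    fix T x assume "T \<in> clifford (product_triple t X1 X2)"
    from comm[OF S subsetD[OF product_clifford_subset this]]
    show "opposite J S (T x) = T (opposite J S x)"
      by (simp add: opposite_eq_conj_op)
  qed
qed

end

text \<open>Both kinds of real structure include \<open>reality_conditions\<close>, which provides
  the two signs and thus lets them be treated together.\<close>

lemma reality_conditions_graded_real:
  assumes X: "even_spectral_triple X"
    and J: "real_structure X J \<or> (\<exists>\<tau>. twisted_real_structure \<tau> X J)"
  obtains \<epsilon> \<epsilon>'' where "graded_real (grading X) J \<epsilon> \<epsilon>''"
proof -
  have "reality_conditions X J"
    using J by (auto simp: real_structure_def twisted_real_structure_def)
  then obtain \<epsilon> \<epsilon>'' :: real where "antilinear_isometry J" "\<epsilon> \<in> {1, -1}" "\<epsilon>'' \<in> {1, -1}"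
    "\<And>x. J (J x) = \<epsilon> *\<^sub>R x" "\<And>x. J (grading X x) = \<epsilon>'' *\<^sub>R grading X (J x)"
    unfolding reality_conditions_def by metis
  then have "graded_real (grading X) J \<epsilon> \<epsilon>''"
    by unfold_locales (simp_all add: even_grading[OF X])
  then show ?thesis
    by (rule that)
qed

theorem proposition30:
  fixes X1 :: "('a::complex_hilbert) even_triple"
    and X2 :: "('b::complex_hilbert) even_triple"
    and J1 :: "'a \<Rightarrow> 'a" and J2 :: "'b \<Rightarrow> 'b"
    and t :: "'a \<Rightarrow> 'b \<Rightarrow> 'c::complex_hilbert"
  assumes "hilbert_tensor t"
    and "even_spectral_triple X1"
    and "even_spectral_triple X2"
    and "real_structure X1 J1 \<or> (\<exists>\<tau>1. twisted_real_structure \<tau>1 X1 J1)"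
    and "real_structure X2 J2 \<or> (\<exists>\<tau>2. twisted_real_structure \<tau>2 X2 J2)"
    and "second_order_condition X1 J1"
    and "second_order_condition X2 J2"
  shows "second_order_condition (product_triple t X1 X2) (product_J t X1 X2 J1 J2)"
proof -
  obtain \<epsilon>1 \<epsilon>1'' where L: "graded_real (grading X1) J1 \<epsilon>1 \<epsilon>1''"
    using assms(2,4) by (rule reality_conditions_graded_real)
  obtain \<epsilon>2 \<epsilon>2'' where R: "graded_real (grading X2) J2 \<epsilon>2 \<epsilon>2''"
    using assms(3,5) by (rule reality_conditions_graded_real)
  interpret product_triples t X1 J1 \<epsilon>1 \<epsilon>1'' X2 J2 \<epsilon>2 \<epsilon>2''
    by (intro product_triples.intro graded_real_product.intro hilbert_tensor_product.intro
        product_triples_axioms.intro assms(1-3) L R)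
  show ?thesis
    using assms(6,7) by (rule second_order_product)
qed


end
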